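(* Let $b_1=b_2b$ with $b_2,b\in H^\infty_1$, and let $(\lambda_n)_{n\ge1}\subset\mathbb C_+$ satisfy $$\sum_n|\mathcal R_{b_1,b_2}(n)-1|<\infty.$$ If the sequence $(\kappa^{b_1}_{\lambda_n})_{n\ge1}$ is a complete AOB in $\mathcal H(b_1)$, then there is an integer $p\ge1$ such that $(\kappa^{b_2}_{\lambda_n})_{n\ge p}$ is a complete AOB in $\mathcal H(b_2)$. Conversely, if $(\kappa^{b_2}_{\lambda_n})_{n\ge1}$ is an AOB in $\mathcal H(b_2)$, then $(\kappa^{b_1}_{\lambda_n})_{n\ge1}$ is an AOB in $\mathcal H(b_1)$.
   Context: A sequence $(x_n)_{n\ge1}$ in a Hilbert space $\mathcal H$ is an *asymptotically orthonormal basic sequence* (AOB) if for all $N\ge1$ there are constants $c_N,C_N>0$ with $c_N\sum_{n\ge N}|a_n|^2\le\|\sum_{n\ge N}a_nx_n\|^2_{\mathcal H}\le C_N\sum_{n\ge N}|a_n|^2$ for every finitely supported complex sequence $(a_n)_n$, and $\lim_N c_N=1=\lim_N C_N$ (similarly for sequences indexed by $n\ge p$). It is complete if its closed linear span is $\mathcal H$. $\mathbb C_+$ is the upper half-plane; $H^\infty_1$ is the closed unit ball of $H^\infty(\mathbb C_+)$. For $b\in H^\infty_1$, the de Branges–Rovnyak space $\mathcal H(b)$, with norm $\|\cdot\|_b$, is the reproducing kernel Hilbert space of analytic functions on $\mathbb C_+$ with kernel $k^b_\lambda(z)=\frac{i}{2\pi}\frac{1-\overline{b(\lambda)}b(z)}{z-\overline\lambda}$;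 $\kappa^b_\lambda=k^b_\lambda/\|k^b_\lambda\|_b$. For $b_1,b_2\in H^\infty_1$ and $(\lambda_n)\subset\mathbb C_+$, $$\mathcal R_{b_1,b_2}(n)=\frac{\|k^{b_1}_{\lambda_n}\|_{b_1}^2}{\|k^{b_2}_{\lambda_n}\|_{b_2}^2}=\frac{1-|b_1(\lambda_n)|^2}{1-|b_2(\lambda_n)|^2}.$$ *)

theory Defs
  imports "HOL-Complex_Analysis.Complex_Analysis"
begin

section \<open>Hilbert spaces of functions\<close>

text \<open>
  A space of complex-valued functions on a set \<open>X\<close>, given by its elements and its inner product
  (linear in the first argument). Since HOL functions are total, functions on \<open>X\<close> are
  represented by functions that vanish outside \<open>X\<close>.
\<close>

record 'a fun_space =
  Elts :: "('a \<Rightarrow> complex) set"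
  iprod :: "('a \<Rightarrow> complex) \<Rightarrow> ('a \<Rightarrow> complex) \<Rightarrow> complex"

definition hnorm :: "'a fun_space \<Rightarrow> ('a \<Rightarrow> complex) \<Rightarrow> real" where
  "hnorm H f = sqrt (Re (iprod H f f))"

locale hilbert_function_space =
  fixes X :: "'a set" and H :: "'a fun_space"
  assumes vanish_outside: "f \<in> Elts H \<Longrightarrow> z \<notin> X \<Longrightarrow> f z = 0"
    and zero_closed: "(\<lambda>z. 0) \<in> Elts H"
    and add_closed: "f \<in> Elts H \<Longrightarrow> g \<in> Elts H \<Longrightarrow> (\<lambda>z. f z + g z) \<in> Elts H"
    and scale_closed: "f \<in> Elts H \<Longrightarrow> (\<lambda>z. c * f z) \<in> Elts H"
    and iprod_add_left:
      "f \<in> Elts H \<Longrightarrow> g \<in> Elts H \<Longrightarrow> h \<in> Elts H \<Longrightarrow>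
        iprod H (\<lambda>z. f z + g z) h = iprod H f h + iprod H g h"
    and iprod_scale_left:
      "f \<in> Elts H \<Longrightarrow> h \<in> Elts H \<Longrightarrow> iprod H (\<lambda>z. c * f z) h = c * iprod H f h"
    and iprod_commute:
      "f \<in> Elts H \<Longrightarrow> g \<in> Elts H \<Longrightarrow> iprod H g f = cnj (iprod H f g)"
    and iprod_nonneg: "f \<in> Elts H \<Longrightarrow> 0 \<le> Re (iprod H f f)"
    and iprod_definite: "f \<in> Elts H \<Longrightarrow> iprod H f f = 0 \<Longrightarrow> f = (\<lambda>z. 0)"
    and complete:
      "(\<And>n. F n \<in> Elts H) \<Longrightarrow>
        (\<forall>e>0. \<exists>M. \<forall>m\<ge>M. \<forall>n\<ge>M. hnorm H (\<lambda>z. F m z - F n z) < e) \<Longrightarrow>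
        \<exists>f\<in>Elts H. (\<lambda>n::nat. hnorm H (\<lambda>z. F n z - f z)) \<longlonglongrightarrow> 0"

text \<open>\<open>K l\<close> is the kernel function at the point \<open>l\<close>, i.e. \<open>K l z\<close> stands for $k_l(z)$.\<close>

locale reproducing_kernel_hilbert_space = hilbert_function_space X H
  for X :: "'a set" and H :: "'a fun_space" +
  fixes K :: "'a \<Rightarrow> 'a \<Rightarrow> complex"
  assumes kernel_closed: "l \<in> X \<Longrightarrow> K l \<in> Elts H"
    and reproducing: "f \<in> Elts H \<Longrightarrow> l \<in> X \<Longrightarrow> f l = iprod H f (K l)"


section \<open>Asymptotically orthonormal basic sequences\<close>

text \<open>
  The sequence is \<open>(x n)\<close> for \<open>n \<ge> p\<close>; values of \<open>x\<close> at smaller indices are irrelevant. The sums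
  are over the finite set of indices \<open>n \<ge> N\<close> in the support of the coefficient sequence.
\<close>

definition AOB :: "'a fun_space \<Rightarrow> nat \<Rightarrow> (nat \<Rightarrow> 'a \<Rightarrow> complex) \<Rightarrow> bool" where
  "AOB H p x \<longleftrightarrow>
    (\<forall>n\<ge>p. x n \<in> Elts H) \<and>
    (\<exists>c C :: nat \<Rightarrow> real.
      (\<forall>N\<ge>p. 0 < c N \<and> 0 < C N \<and>
        (\<forall>a :: nat \<Rightarrow> complex. finite {n. a n \<noteq> 0} \<longrightarrow>
          c N * (\<Sum>n | N \<le> n \<and> a n \<noteq> 0. (cmod (a n))\<^sup>2)
            \<le> (hnorm H (\<lambda>z. \<Sum>n | N \<le> n \<and> a n \<noteq> 0. a n * x n z))\<^sup>2 \<and>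
          (hnorm H (\<lambda>z. \<Sum>n | N \<le> n \<and> a n \<noteq> 0. a n * x n z))\<^sup>2
            \<le> C N * (\<Sum>n | N \<le> n \<and> a n \<noteq> 0. (cmod (a n))\<^sup>2))) \<and>
      c \<longlonglongrightarrow> 1 \<and> C \<longlonglongrightarrow> 1)"

definition lin_span :: "('a \<Rightarrow> complex) set \<Rightarrow> ('a \<Rightarrow> complex) set" where
  "lin_span S = {f. \<exists>A a. finite A \<and> A \<subseteq> S \<and> f = (\<lambda>z. \<Sum>g\<in>A. a g * g z)}"

definition norm_closure :: "'a fun_space \<Rightarrow> ('a \<Rightarrow> complex) set \<Rightarrow> ('a \<Rightarrow> complex) set" where
  "norm_closure H S = {f \<in> Elts H. \<forall>e>0. \<exists>g\<in>S. hnorm H (\<lambda>z. f z - g z) < e}"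

definition complete_seq :: "'a fun_space \<Rightarrow> nat \<Rightarrow> (nat \<Rightarrow> 'a \<Rightarrow> complex) \<Rightarrow> bool" where
  "complete_seq H p x \<longleftrightarrow> norm_closure H (lin_span (x ` {p..})) = Elts H"


section \<open>De Branges--Rovnyak spaces on the upper half-plane\<close>

definition upper_half_plane :: "complex set" where
  "upper_half_plane = {z. 0 < Im z}"

definition Hinf :: "(complex \<Rightarrow> complex) set" where
  "Hinf = {f. f holomorphic_on upper_half_plane \<and> bounded (f ` upper_half_plane)}"

definition Hinf_norm :: "(complex \<Rightarrow> complex) \<Rightarrow> real" where
  "Hinf_norm f = (SUP z\<in>upper_half_plane. cmod (f z))"

definition Hinf_ball :: "(complex \<Rightarrow> complex) set" where
  "Hinf_ball = {f \<in> Hinf. Hinf_norm f \<le> 1}"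

definition dbr_kernel :: "(complex \<Rightarrow> complex) \<Rightarrow> complex \<Rightarrow> complex \<Rightarrow> complex" where
  "dbr_kernel b l z =
    (if z \<in> upper_half_plane
     then \<i> / (2 * of_real pi) * ((1 - cnj (b l) * b z) / (z - cnj l))
     else 0)"

text \<open>
  The following locale predicate says that \<open>H\<close> is the space $\mathcal H(b)$. A reproducing kernel
  Hilbert space is determined by its kernel, so for given \<open>b\<close> in the unit ball of $H^\infty$ the
  elements of \<open>H\<close> and the inner product on them are unique; existence is the Moore--Aronszajn
  theorem.
\<close>

locale de_branges_rovnyak_space =
  reproducing_kernel_hilbert_space upper_half_plane H "dbr_kernel b"
  for b :: "complex \<Rightarrow> complex" and H :: "complex fun_space" +
  assumes analytic: "f \<in> Elts H \<Longrightarrow> f holomorphic_on upper_half_plane"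

definition normalized_kernel ::
    "(complex \<Rightarrow> complex) \<Rightarrow> complex fun_space \<Rightarrow> complex \<Rightarrow> complex \<Rightarrow> complex" where
  "normalized_kernel b H l = (\<lambda>z. dbr_kernel b l z / of_real (hnorm H (dbr_kernel b l)))"

text \<open>
  The quotient $\mathcal R_{b_1,b_2}$ at a point \<open>l\<close>, for \<open>H1\<close> $= \mathcal H(b_1)$ and \<open>H2\<close>
  $= \mathcal H(b_2)$. If \<open>b2\<close> is a unimodular constant, then $\mathcal H(b_2) = 0$ and the quotient
  is \<open>0\<close> by the HOL convention for division; its distance to \<open>1\<close> is then not summable along any
  infinite sequence of points.
\<close>

definition kernel_ratio ::
    "(complex \<Rightarrow> complex) \<Rightarrow> complex fun_space \<Rightarrow> (complex \<Rightarrow> complex) \<Rightarrow> complex fun_space \<Rightarrow>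
      complex \<Rightarrow> real" where
  "kernel_ratio b1 H1 b2 H2 l = (hnorm H1 (dbr_kernel b1 l))\<^sup>2 / (hnorm H2 (dbr_kernel b2 l))\<^sup>2"

lemma (in de_branges_rovnyak_space) hnorm_kernel:
  assumes "l \<in> upper_half_plane"
  shows "(hnorm H (dbr_kernel b l))\<^sup>2 = (1 - (cmod (b l))\<^sup>2) / (4 * pi * Im l)"
proof -
  have "Im l > 0" using assms by (simp add: upper_half_plane_def)
  have "iprod H (dbr_kernel b l) (dbr_kernel b l) = dbr_kernel b l l"
    using reproducing[OF kernel_closed[OF assms] assms] by simp
  also have "\<dots> = \<i> / (2 * of_real pi) * ((1 - cnj (b l) * b l) / (l - cnj l))"
    using assms by (simp add: dbr_kernel_def)
  also have "cnj (b l) * b l = of_real ((cmod (b l))\<^sup>2)"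
    by (metis complex_norm_square mult.commute)
  also have "l - cnj l = of_real (2 * Im l) * \<i>"
    by (simp add: complex_eq_iff)
  also have "\<i> / (2 * of_real pi) * ((1 - of_real ((cmod (b l))\<^sup>2)) / (of_real (2 * Im l) * \<i>))
      = of_real ((1 - (cmod (b l))\<^sup>2) / (4 * pi * Im l))"
    using \<open>Im l > 0\<close> by (simp add: field_simps)
  finally have "Re (iprod H (dbr_kernel b l) (dbr_kernel b l))
      = (1 - (cmod (b l))\<^sup>2) / (4 * pi * Im l)" by (metis Re_complex_of_real)
  then show ?thesis
    using iprod_nonneg[OF kernel_closed[OF assms]] by (simp add: hnorm_def)
qed

lemma kernel_ratio_eq:
  assumes "de_branges_rovnyak_space b1 H1" "de_branges_rovnyak_space b2 H2"
    and "l \<in> upper_half_plane"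
  shows "kernel_ratio b1 H1 b2 H2 l = (1 - (cmod (b1 l))\<^sup>2) / (1 - (cmod (b2 l))\<^sup>2)"
  using assms(3) unfolding kernel_ratio_def
    de_branges_rovnyak_space.hnorm_kernel[OF assms(1,3)]
    de_branges_rovnyak_space.hnorm_kernel[OF assms(2,3)]
  by (simp add: upper_half_plane_def)

end

theory Submission
  imports Defs
begin

text \<open>
  Since \<open>1 - b\<^sub>1(w)\<^sup>* b\<^sub>1(z) = (1 - b\<^sub>2(w)\<^sup>* b\<^sub>2(z)) + b\<^sub>2(w)\<^sup>* b\<^sub>2(z) (1 - b(w)\<^sup>* b(z))\<close>, the kernel of the
  first space is the kernel of the second plus a ``defect'' \<open>b\<^sub>2(w)\<^sup>* b\<^sub>2(z) k\<^sup>b\<^sub>w(z)\<close>. The defect is a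
  positive kernel because \<open>b\<close> is in the unit ball (\<open>dbr_kernel_positive\<close>, proved with Szego kernels
  of discs exhausting the half-plane). Hence, for all finite combinations,
  \<open>\<parallel>\<Sum> a\<^sub>n k\<^sup>1\<^sub>n\<parallel>\<^sup>2 = \<parallel>\<Sum> a\<^sub>n k\<^sup>2\<^sub>n\<parallel>\<^sup>2 + E(a)\<close> with \<open>E \<ge> 0\<close>, and a positive form is bounded by its trace.
  After normalisation the trace over \<open>n \<ge> N\<close> is at most the tail \<open>\<delta>\<^sub>N\<close> of the series
  \<open>\<Sum> |R(n) - 1|\<close>. So the two sequences of normalised kernels satisfy the same two-sided estimates up
  to factors and terms tending to \<open>1\<close> and \<open>0\<close>: this gives the converse statement, and in the direct
  one it shows that the normalised kernels of the second space are asymptotically orthonormal from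
  some index \<open>q\<close> on (\<open>AOB_up\<close>, \<open>AOB_down\<close>).

  For completeness, \<open>k\<^sup>1\<^sub>\<mu> \<mapsto> k\<^sup>2\<^sub>\<mu>\<close> is a contraction, so completeness in the first space makes
  \<open>(\<lambda>\<^sub>n)\<close>, \<open>n \<ge> 1\<close>, a set of uniqueness for the second. By the lower estimate the tails with
  \<open>n > q\<close> are not sets of uniqueness, so there is a largest \<open>p \<le> q\<close> such that the points with
  \<open>n \<ge> p\<close> form one. This is the index of the theorem. It remains to extend the lower estimate from
  \<open>q\<close> down to \<open>p\<close>, for which it suffices that, for every \<open>m \<ge> p\<close>, some function in the second space
  vanishes at all \<open>\<lambda>\<^sub>n\<close>, \<open>n \<ge> p\<close>, except \<open>\<lambda>\<^sub>m\<close> (\<open>AOB_prepend\<close>). By maximality of \<open>p\<close> there is a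
  nonzero \<open>f\<close> vanishing at all \<open>\<lambda>\<^sub>n\<close> with \<open>n > p\<close>, and multiplying it by
  \<open>(z - \<lambda>\<^sub>p) / (z - \<lambda>\<^sub>m)\<close> keeps it in the space (\<open>exchange_zero\<close>) and gives the function wanted.
\<close>

section \<open>Hilbert spaces of functions\<close>

context hilbert_function_space
begin

lemma diff_closed:
  assumes "f \<in> Elts H" "g \<in> Elts H"
  shows "(\<lambda>z. f z - g z) \<in> Elts H"
  using add_closed[OF assms(1) scale_closed[OF assms(2), of "-1"]] by simp

lemma sum_closed:
  assumes "\<And>i. i \<in> F \<Longrightarrow> x i \<in> Elts H"
  shows "(\<lambda>z. \<Sum>i\<in>F. a i * x i z) \<in> Elts H"
  using assms
proof (induction F rule: infinite_finite_induct)
  case (insert j F)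
  then have "(\<lambda>z. a j * x j z + (\<Sum>i\<in>F. a i * x i z)) \<in> Elts H"
    by (intro add_closed scale_closed) auto
  then show ?case using insert by simp
qed (simp_all add: zero_closed)

lemma iprod_zero_left: "h \<in> Elts H \<Longrightarrow> iprod H (\<lambda>z. 0) h = 0"
  using iprod_scale_left[of "\<lambda>z. 0" h 0] zero_closed by simp

lemma iprod_sum_left:
  assumes "\<And>i. i \<in> F \<Longrightarrow> x i \<in> Elts H" "h \<in> Elts H"
  shows "iprod H (\<lambda>z. \<Sum>i\<in>F. a i * x i z) h = (\<Sum>i\<in>F. a i * iprod H (x i) h)"
  using assms
proof (induction F rule: infinite_finite_induct)
  case (insert j F)
  have "iprod H (\<lambda>z. a j * x j z + (\<Sum>i\<in>F. a i * x i z)) h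
      = a j * iprod H (x j) h + iprod H (\<lambda>z. \<Sum>i\<in>F. a i * x i z) h"
    using insert.prems by (subst iprod_add_left) (auto intro: scale_closed sum_closed
        simp: iprod_scale_left)
  then show ?case using insert by simp
qed (simp_all add: iprod_zero_left)

lemma iprod_add_right:
  assumes "f \<in> Elts H" "g \<in> Elts H" "h \<in> Elts H"
  shows "iprod H h (\<lambda>z. f z + g z) = iprod H h f + iprod H h g"
  unfolding iprod_commute[OF add_closed[OF assms(1,2)] assms(3)] iprod_add_left[OF assms]
  by (simp add: iprod_commute[OF assms(1,3)] iprod_commute[OF assms(2,3)])

lemma iprod_scale_right:
  assumes "f \<in> Elts H" "h \<in> Elts H"
  shows "iprod H h (\<lambda>z. c * f z) = cnj c * iprod H h f"
  unfolding iprod_commute[OF scale_closed[OF assms(1)] assms(2)] iprod_scale_left[OF assms]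
  by (simp add: iprod_commute[OF assms])

lemma iprod_diff_left:
  assumes "f \<in> Elts H" "g \<in> Elts H" "h \<in> Elts H"
  shows "iprod H (\<lambda>z. f z - g z) h = iprod H f h - iprod H g h"
  using iprod_add_left[OF assms(1) scale_closed[OF assms(2), of "-1"] assms(3)]
    iprod_scale_left[OF assms(2,3), of "-1"] by simp

lemma iprod_diff_right:
  assumes "f \<in> Elts H" "g \<in> Elts H" "h \<in> Elts H"
  shows "iprod H h (\<lambda>z. f z - g z) = iprod H h f - iprod H h g"
  using iprod_add_right[OF assms(1) scale_closed[OF assms(2), of "-1"] assms(3)]
    iprod_scale_right[OF assms(2,3), of "-1"] by simp

lemma iprod_sum_right:
  assumes "\<And>i. i \<in> F \<Longrightarrow> x i \<in> Elts H" "h \<in> Elts H"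
  shows "iprod H h (\<lambda>z. \<Sum>i\<in>F. a i * x i z) = (\<Sum>i\<in>F. cnj (a i) * iprod H h (x i))"
proof -
  have "iprod H h (\<lambda>z. \<Sum>i\<in>F. a i * x i z) = cnj (iprod H (\<lambda>z. \<Sum>i\<in>F. a i * x i z) h)"
    by (rule iprod_commute[OF sum_closed assms(2)]) (rule assms(1))
  also have "\<dots> = cnj (\<Sum>i\<in>F. a i * iprod H (x i) h)"
    by (simp only: iprod_sum_left[OF assms])
  also have "\<dots> = (\<Sum>i\<in>F. cnj (a i) * iprod H h (x i))"
    using assms by (auto simp: intro!: sum.cong iprod_commute[symmetric])
  finally show ?thesis .
qed

lemma hnorm_nonneg: "f \<in> Elts H \<Longrightarrow> 0 \<le> hnorm H f"
  by (simp add: hnorm_def iprod_nonneg)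

lemma hnorm_sq: "f \<in> Elts H \<Longrightarrow> (hnorm H f)\<^sup>2 = Re (iprod H f f)"
  by (simp add: hnorm_def iprod_nonneg)

lemma iprod_self: "f \<in> Elts H \<Longrightarrow> iprod H f f = of_real ((hnorm H f)\<^sup>2)"
  using arg_cong[OF iprod_commute[of f f], of Im] by (simp add: hnorm_sq complex_eq_iff)

lemma hnorm_zero: "hnorm H (\<lambda>z. 0) = 0"
  by (simp add: hnorm_def iprod_zero_left zero_closed)

lemma hnorm_eq_zeroD: "f \<in> Elts H \<Longrightarrow> hnorm H f = 0 \<Longrightarrow> f = (\<lambda>z. 0)"
  by (rule iprod_definite) (simp_all add: iprod_self)

lemma hnorm_scale_sq:
  assumes "f \<in> Elts H"
  shows "(hnorm H (\<lambda>z. c * f z))\<^sup>2 = (cmod c)\<^sup>2 * (hnorm H f)\<^sup>2"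
proof -
  have "iprod H (\<lambda>z. c * f z) (\<lambda>z. c * f z) = (c * cnj c) * iprod H f f"
    using assms scale_closed[OF assms, of c] by (simp add: iprod_scale_left iprod_scale_right)
  also have "\<dots> = of_real ((cmod c)\<^sup>2 * (hnorm H f)\<^sup>2)"
    by (simp only: complex_norm_square[symmetric] iprod_self[OF assms] of_real_mult)
  finally have "iprod H (\<lambda>z. c * f z) (\<lambda>z. c * f z) = of_real ((cmod c)\<^sup>2 * (hnorm H f)\<^sup>2)" .
  then show ?thesis using scale_closed[OF assms] by (metis Re_complex_of_real hnorm_sq)
qed

lemma hnorm_add_sq:
  assumes "f \<in> Elts H" "g \<in> Elts H"
  shows "(hnorm H (\<lambda>z. f z + g z))\<^sup>2 = (hnorm H f)\<^sup>2 + (hnorm H g)\<^sup>2 + 2 * Re (iprod H f g)"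
  using assms iprod_commute[OF assms]
  by (simp add: hnorm_sq add_closed iprod_add_left iprod_add_right)

lemma hnorm_diff_sq:
  assumes "f \<in> Elts H" "g \<in> Elts H"
  shows "(hnorm H (\<lambda>z. f z - g z))\<^sup>2 = (hnorm H f)\<^sup>2 + (hnorm H g)\<^sup>2 - 2 * Re (iprod H f g)"
  using assms iprod_commute[OF assms]
  by (simp add: hnorm_sq diff_closed iprod_diff_left iprod_diff_right)

lemma hnorm_diff_commute:
  assumes "f \<in> Elts H" "g \<in> Elts H"
  shows "hnorm H (\<lambda>z. f z - g z) = hnorm H (\<lambda>z. g z - f z)"
proof (rule power2_eq_imp_eq)
  show "(hnorm H (\<lambda>z. f z - g z))\<^sup>2 = (hnorm H (\<lambda>z. g z - f z))\<^sup>2"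
    using iprod_commute[OF assms] by (simp add: hnorm_diff_sq assms)
qed (auto intro: hnorm_nonneg diff_closed assms)

lemma hnorm_diff_sq_le:
  assumes "f \<in> Elts H" "g \<in> Elts H"
  shows "(hnorm H (\<lambda>z. f z - g z))\<^sup>2 \<le> 2 * (hnorm H f)\<^sup>2 + 2 * (hnorm H g)\<^sup>2"
  using hnorm_add_sq[OF assms] hnorm_diff_sq[OF assms]
    zero_le_power2[of "hnorm H (\<lambda>z. f z + g z)"] by linarith

lemma hnorm_add_sq_le:
  assumes "f \<in> Elts H" "g \<in> Elts H"
  shows "(hnorm H (\<lambda>z. f z + g z))\<^sup>2 \<le> 2 * (hnorm H f)\<^sup>2 + 2 * (hnorm H g)\<^sup>2"
  using hnorm_add_sq[OF assms] hnorm_diff_sq[OF assms]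
    zero_le_power2[of "hnorm H (\<lambda>z. f z - g z)"] by linarith

lemma hnorm_sum_sq:
  assumes "\<And>i. i \<in> F \<Longrightarrow> x i \<in> Elts H"
  shows "(hnorm H (\<lambda>z. \<Sum>i\<in>F. a i * x i z))\<^sup>2
      = Re (\<Sum>i\<in>F. \<Sum>j\<in>F. a i * cnj (a j) * iprod H (x i) (x j))"
proof -
  have "iprod H (\<lambda>z. \<Sum>i\<in>F. a i * x i z) (\<lambda>z. \<Sum>i\<in>F. a i * x i z)
      = (\<Sum>i\<in>F. a i * (\<Sum>j\<in>F. cnj (a j) * iprod H (x i) (x j)))"
    using assms by (simp add: iprod_sum_left iprod_sum_right sum_closed)
  then show ?thesis
    using assms by (simp add: hnorm_sq sum_closed sum_distrib_left mult_ac)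
qed

lemma hilbert_cauchy_schwarz:
  assumes "f \<in> Elts H" "g \<in> Elts H"
  shows "cmod (iprod H f g) \<le> hnorm H f * hnorm H g"
proof (cases "hnorm H g = 0")
  case True
  then have "g = (\<lambda>z. 0)" using hnorm_eq_zeroD assms by blast
  then have "iprod H f g = 0"
    using iprod_commute[OF assms(2,1)] iprod_zero_left[OF assms(1)] by simp
  then show ?thesis using True by simp
next
  case False
  define s where "s = (hnorm H g)\<^sup>2"
  define w where "w = iprod H f g"
  have s: "s > 0" using False by (simp add: s_def)
  have "0 \<le> (hnorm H (\<lambda>z. f z - w / s * g z))\<^sup>2" by simp
  also have "\<dots> = (hnorm H f)\<^sup>2 + (cmod (w / s))\<^sup>2 * s - 2 * Re (cnj (w / s) * w)"
    unfolding hnorm_diff_sq[OF assms(1) scale_closed[OF assms(2)]] hnorm_scale_sq[OF assms(2)]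
      iprod_scale_right[OF assms(2,1)] s_def w_def by simp
  also have "cnj (w / s) * w = of_real ((cmod w)\<^sup>2 / s)"
  proof -
    have "cnj (w / s) * w = (w * cnj w) / s" by simp
    then show ?thesis by (simp only: complex_norm_square of_real_divide)
  qed
  also have "(cmod (w / s))\<^sup>2 * s = (cmod w)\<^sup>2 / s"
    using s by (simp add: norm_divide power_divide power2_eq_square)
  finally have "(cmod w)\<^sup>2 / s \<le> (hnorm H f)\<^sup>2"
    unfolding Re_complex_of_real by linarith
  then have "(cmod w)\<^sup>2 \<le> (hnorm H f * hnorm H g)\<^sup>2"
    using s by (simp add: s_def divide_le_eq power_mult_distrib)
  then show ?thesis
    unfolding w_def by (rule power2_le_imp_le) (simp add: assms hnorm_nonneg)
qed

lemma lin_span_image: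
  "lin_span (x ` I) = {\<lambda>z. \<Sum>i\<in>F. a i * x i z | F a. finite F \<and> F \<subseteq> I}"
proof (intro subset_antisym subsetI)
  fix f assume "f \<in> lin_span (x ` I)"
  then obtain A a where A: "finite A" "A \<subseteq> x ` I" "f = (\<lambda>z. \<Sum>g\<in>A. a g * g z)"
    unfolding lin_span_def by blast
  obtain F where F: "F \<subseteq> I" "finite F" "A = x ` F" "inj_on x F"
    using A(1,2) by (metis finite_imageD subset_image_inj)
  have "f = (\<lambda>z. \<Sum>i\<in>F. a (x i) * x i z)"
    using A(3) F by (simp add: sum.reindex)
  then show "f \<in> {\<lambda>z. \<Sum>i\<in>F. a i * x i z | F a. finite F \<and> F \<subseteq> I}"
    using F by (auto intro!: exI[of _ F] exI[of _ "\<lambda>i. a (x i)"])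
next
  fix f assume "f \<in> {\<lambda>z. \<Sum>i\<in>F. a i * x i z | F a. finite F \<and> F \<subseteq> I}"
  then obtain F a where F: "finite F" "F \<subseteq> I" "f = (\<lambda>z. \<Sum>i\<in>F. a i * x i z)" by blast
  have "f = (\<lambda>z. \<Sum>g\<in>x ` F. (\<Sum>i | i \<in> F \<and> x i = g. a i) * g z)"
    unfolding F(3) by (subst sum.image_gen[OF F(1), of _ x]) (simp add: sum_distrib_right)
  then show "f \<in> lin_span (x ` I)"
    unfolding lin_span_def using F(1,2)
    by (auto intro!: exI[of _ "x ` F"] exI[of _ "\<lambda>g. \<Sum>i | i \<in> F \<and> x i = g. a i"])
qed

text \<open>
  A moment problem: a family \<open>x\<close> and prescribed values \<open>l\<close> are the values \<open>\<langle>x i, G\<rangle>\<close> of a vector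
  \<open>G\<close> in the closed span of the family as soon as the functional \<open>x i \<mapsto> l i\<close> is bounded. This is
  Riesz representation on the closed span, obtained by minimising \<open>\<parallel>u\<parallel>\<^sup>2 - 2 Re L u\<close>. The
  hypothesis also makes the functional well defined, so no linear independence is needed.
\<close>

lemma moment_problem:
  fixes x :: "'i \<Rightarrow> 'a \<Rightarrow> complex" and l :: "'i \<Rightarrow> complex"
  assumes x: "\<And>i. i \<in> I \<Longrightarrow> x i \<in> Elts H"
    and bd: "\<And>F a. finite F \<Longrightarrow> F \<subseteq> I \<Longrightarrow>
      cmod (\<Sum>i\<in>F. a i * l i) \<le> C * hnorm H (\<lambda>z. \<Sum>i\<in>F. a i * x i z)"
  shows "\<exists>G \<in> norm_closure H (lin_span (x ` I)). \<forall>i\<in>I. iprod H (x i) G = l i"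
proof -
  define U where "U = {(\<lambda>z. \<Sum>i\<in>F. a i * x i z, \<Sum>i\<in>F. a i * l i) | F a. finite F \<and> F \<subseteq> I}"
  define J where "J = (\<lambda>p. (hnorm H (fst p))\<^sup>2 - 2 * Re (snd p))"
  have UE: "u \<in> Elts H" "u \<in> lin_span (x ` I)" "cmod v \<le> C * hnorm H u" if uv: "(u, v) \<in> U" for u v
  proof -
    obtain F a where F: "finite F" "F \<subseteq> I"
      and u: "u = (\<lambda>z. \<Sum>i\<in>F. a i * x i z)" and v: "v = (\<Sum>i\<in>F. a i * l i)"
      using uv unfolding U_def by blast
    show "u \<in> Elts H" unfolding u using F x by (intro sum_closed) auto
    show "u \<in> lin_span (x ` I)" unfolding lin_span_image u using F by blast
    show "cmod v \<le> C * hnorm H u" unfolding u v by (rule bd[OF F])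
  qed
  have Uscale: "(\<lambda>z. t * u z, t * v) \<in> U" if uv: "(u, v) \<in> U" for t u v
  proof -
    obtain F a where F: "finite F" "F \<subseteq> I"
      and u: "u = (\<lambda>z. \<Sum>i\<in>F. a i * x i z)" and v: "v = (\<Sum>i\<in>F. a i * l i)"
      using uv unfolding U_def by blast
    show ?thesis unfolding U_def u v using F
      by (auto intro!: exI[of _ F] exI[of _ "\<lambda>i. t * a i"] simp: sum_distrib_left mult.assoc)
  qed
  have Uadd: "(\<lambda>z. u z + u' z, v + v') \<in> U" if uv: "(u, v) \<in> U" "(u', v') \<in> U" for u v u' v'
  proof -
    obtain F a where F: "finite F" "F \<subseteq> I"
      and u: "u = (\<lambda>z. \<Sum>i\<in>F. a i * x i z)" and v: "v = (\<Sum>i\<in>F. a i * l i)"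
      using uv(1) unfolding U_def by blast
    obtain F' a' where F': "finite F'" "F' \<subseteq> I"
      and u': "u' = (\<lambda>z. \<Sum>i\<in>F'. a' i * x i z)" and v': "v' = (\<Sum>i\<in>F'. a' i * l i)"
      using uv(2) unfolding U_def by blast
    define A where "A = (\<lambda>i. (if i \<in> F then a i else 0) + (if i \<in> F' then a' i else 0))"
    have A: "(\<Sum>i\<in>F. a i * y i) + (\<Sum>i\<in>F'. a' i * y i) = (\<Sum>i\<in>F \<union> F'. A i * y i)"
      for y :: "'i \<Rightarrow> complex"
    proof -
      have "(\<Sum>i\<in>F \<union> F'. A i * y i) = (\<Sum>i\<in>F \<union> F'. (if i \<in> F then a i else 0) * y i)
          + (\<Sum>i\<in>F \<union> F'. (if i \<in> F' then a' i else 0) * y i)"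
        by (simp add: A_def distrib_right sum.distrib)
      also have "(\<Sum>i\<in>F \<union> F'. (if i \<in> F then a i else 0) * y i) = (\<Sum>i\<in>F. a i * y i)"
        using F(1) F'(1) by (intro sum.mono_neutral_cong_right) auto
      also have "(\<Sum>i\<in>F \<union> F'. (if i \<in> F' then a' i else 0) * y i) = (\<Sum>i\<in>F'. a' i * y i)"
        using F(1) F'(1) by (intro sum.mono_neutral_cong_right) auto
      finally show ?thesis by simp
    qed
    show ?thesis unfolding U_def u v u' v' A using F F' by blast
  qed
  have U0: "(\<lambda>z. 0, 0) \<in> U" unfolding U_def by (auto intro!: exI[of _ "{}"])
  have Ux: "(x i, l i) \<in> U" if "i \<in> I" for i
    unfolding U_def using that by (auto intro!: exI[of _ "{i}"] exI[of _ "\<lambda>_. 1"])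
  have Jlow: "- C\<^sup>2 \<le> J p" if "p \<in> U" for p
  proof -
    obtain u v where p: "p = (u, v)" by (cases p)
    have "Re v \<le> C * hnorm H u" using UE(3)[of u v] that p complex_Re_le_cmod[of v] by simp
    moreover have "0 \<le> (hnorm H u - C)\<^sup>2" by simp
    ultimately show ?thesis by (simp add: J_def p power2_eq_square algebra_simps)
  qed
  define m where "m = Inf (J ` U)"
  have bdd: "bdd_below (J ` U)" using Jlow by (auto intro!: bdd_belowI2)
  have mle: "m \<le> J p" if "p \<in> U" for p
    unfolding m_def using that bdd by (simp add: cINF_lower)
  have "\<exists>p\<in>U. J p < m + 1 / (real n + 1)" for n :: nat
  proof -
    have "Inf (J ` U) < m + 1 / (real n + 1)" by (simp add: m_def)
    then show ?thesis using U0 bdd by (subst (asm) cInf_less_iff) auto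
  qed
  then obtain p where p: "\<And>n::nat. p n \<in> U" "\<And>n. J (p n) < m + 1 / (real n + 1)" by metis
  define u where "u = (\<lambda>n. fst (p n))"
  define v where "v = (\<lambda>n. snd (p n))"
  have pU: "(u n, v n) \<in> U" for n using p(1)[of n] by (simp add: u_def v_def)
  have pJ: "(hnorm H (u n))\<^sup>2 - 2 * Re (v n) < m + 1 / (real n + 1)" for n
    using p(2)[of n] by (simp add: u_def v_def J_def)
  note uE = UE(1)[OF pU]
  \<comment> \<open>By the parallelogram law a minimising sequence is Cauchy.\<close>
  have par: "(hnorm H (\<lambda>z. u n z - u k z))\<^sup>2 \<le> 2 / (real n + 1) + 2 / (real k + 1)" for n k :: nat
  proof -
    have "(\<lambda>z. 1/2 * (u n z + u k z), 1/2 * (v n + v k)) \<in> U" by (intro Uscale Uadd pU)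
    from mle[OF this]
    have "m \<le> 1/4 * (hnorm H (\<lambda>z. u n z + u k z))\<^sup>2 - (Re (v n) + Re (v k))"
      unfolding J_def fst_conv snd_conv hnorm_scale_sq[OF add_closed[OF uE uE]]
      by (simp add: power2_eq_square add_divide_distrib)
    with pJ[of n] pJ[of k] hnorm_add_sq[OF uE uE, of n k] hnorm_diff_sq[OF uE uE, of n k]
    show ?thesis by (simp add: add_divide_distrib)
  qed
  have "\<exists>M. \<forall>n\<ge>M. \<forall>k\<ge>M. hnorm H (\<lambda>z. u n z - u k z) < e" if e: "e > 0" for e
  proof -
    obtain M :: nat where M: "inverse (Suc M) < e\<^sup>2 / 4"
      using reals_Archimedean[of "e\<^sup>2 / 4"] e by auto
    have "hnorm H (\<lambda>z. u n z - u k z) < e" if "n \<ge> M" "k \<ge> M" for n k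
    proof -
      have "1 / (real n + 1) \<le> inverse (Suc M)" "1 / (real k + 1) \<le> inverse (Suc M)"
        using that by (auto simp: inverse_eq_divide frac_le)
      with par[of n k] M have "(hnorm H (\<lambda>z. u n z - u k z))\<^sup>2 < e\<^sup>2" by simp
      then show ?thesis using e by (simp add: power_less_imp_less_base)
    qed
    then show ?thesis by blast
  qed
  then have "\<forall>e>0. \<exists>M. \<forall>n\<ge>M. \<forall>k\<ge>M. hnorm H (\<lambda>z. u n z - u k z) < e" by simp
  from complete[OF uE this] obtain G
    where G: "G \<in> Elts H" and lim: "(\<lambda>n. hnorm H (\<lambda>z. u n z - G z)) \<longlonglongrightarrow> 0" ..
  have dist_sym: "hnorm H (\<lambda>z. G z - u n z) = hnorm H (\<lambda>z. u n z - G z)" for n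
    by (rule hnorm_diff_commute[OF G uE])
  have "G \<in> norm_closure H (lin_span (x ` I))"
    unfolding norm_closure_def
  proof (intro CollectI conjI G allI impI)
    fix e :: real assume "e > 0"
    from order_tendstoD(2)[OF lim this] obtain n where "hnorm H (\<lambda>z. u n z - G z) < e"
      using eventually_happens'[OF sequentially_bot] by force
    then show "\<exists>g\<in>lin_span (x ` I). hnorm H (\<lambda>z. G z - g z) < e"
      by (intro bexI[OF _ UE(2)[OF pU, of n]]) (simp add: dist_sym)
  qed
  moreover have "iprod H (x i) G = l i" if i: "i \<in> I" for i
  proof -
    define y where "y = iprod H G (x i) - cnj (l i)"
    define s where "s = 1 / (1 + (hnorm H (x i))\<^sup>2)"
    have limi: "(\<lambda>n. iprod H (u n) (x i)) \<longlonglongrightarrow> iprod H G (x i)"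
    proof (rule LIM_zero_cancel, rule tendsto_norm_zero_cancel, rule tendsto_sandwich[OF _ _ tendsto_const])
      show "\<forall>\<^sub>F n in sequentially. cmod (iprod H (u n) (x i) - iprod H G (x i))
          \<le> hnorm H (\<lambda>z. u n z - G z) * hnorm H (x i)"
        using hilbert_cauchy_schwarz[OF diff_closed[OF uE G] x[OF i]]
        by (simp add: iprod_diff_left[OF uE G x[OF i]])
      show "(\<lambda>n. hnorm H (\<lambda>z. u n z - G z) * hnorm H (x i)) \<longlonglongrightarrow> 0"
        using tendsto_mult_right[OF lim, of "hnorm H (x i)"] by simp
    qed simp
    have "- 1 / (real n + 1) \<le> (cmod t)\<^sup>2 * (hnorm H (x i))\<^sup>2
        + 2 * Re (cnj t * (iprod H (u n) (x i) - cnj (l i)))" for t n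
    proof -
      have "(\<lambda>z. u n z + t * x i z, v n + t * l i) \<in> U" by (intro Uscale Uadd pU Ux i)
      from mle[OF this]
      have "m \<le> (hnorm H (u n))\<^sup>2 + (cmod t)\<^sup>2 * (hnorm H (x i))\<^sup>2
          + 2 * Re (cnj t * iprod H (u n) (x i)) - 2 * Re (v n + t * l i)"
        unfolding J_def fst_conv snd_conv hnorm_add_sq[OF uE scale_closed[OF x[OF i]]]
          hnorm_scale_sq[OF x[OF i]] iprod_scale_right[OF x[OF i] uE] .
      with pJ[of n] show ?thesis by (simp add: algebra_simps)
    qed
    then have pos: "0 \<le> (cmod t)\<^sup>2 * (hnorm H (x i))\<^sup>2
        + 2 * Re (cnj t * (iprod H G (x i) - cnj (l i)))" for t
    proof (intro LIMSEQ_le[where X = "\<lambda>n. - 1 / (real n + 1)"])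
      show "(\<lambda>n. - 1 / (real n + 1)) \<longlonglongrightarrow> 0" by real_asymp
      show "(\<lambda>n. (cmod t)\<^sup>2 * (hnorm H (x i))\<^sup>2 + 2 * Re (cnj t * (iprod H (u n) (x i) - cnj (l i))))
        \<longlonglongrightarrow> (cmod t)\<^sup>2 * (hnorm H (x i))\<^sup>2 + 2 * Re (cnj t * (iprod H G (x i) - cnj (l i)))"
        by (intro tendsto_intros limi)
    qed auto
    have n: "(cmod (- of_real s * y))\<^sup>2 = s\<^sup>2 * (cmod y)\<^sup>2"
      by (simp add: norm_mult power_mult_distrib)
    have e: "Re (cnj (- of_real s * y) * y) = - (s * (cmod y)\<^sup>2)"
      unfolding cmod_power2 by (simp add: power2_eq_square algebra_simps)
    have "0 \<le> s\<^sup>2 * (cmod y)\<^sup>2 * (hnorm H (x i))\<^sup>2 + 2 * - (s * (cmod y)\<^sup>2)"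
      using pos[of "- of_real s * y"] unfolding y_def[symmetric] n e .
    then have "0 \<le> (cmod y)\<^sup>2 * (s * (s * (hnorm H (x i))\<^sup>2 - 2))"
      by (simp add: power2_eq_square algebra_simps)
    moreover have "1 + (hnorm H (x i))\<^sup>2 > 0" by (simp add: add_pos_nonneg)
    then have "s > 0" "s * (hnorm H (x i))\<^sup>2 \<le> 1" by (auto simp: s_def)
    then have "s * (s * (hnorm H (x i))\<^sup>2 - 2) < 0" by (intro mult_pos_neg) auto
    ultimately have "y = 0"
      using mult_pos_neg[of "(cmod y)\<^sup>2" "s * (s * (hnorm H (x i))\<^sup>2 - 2)"] by force
    then have "iprod H G (x i) = cnj (l i)" by (simp add: y_def)
    then show ?thesis using iprod_commute[OF G x[OF i]] by simp
  qed
  ultimately show ?thesis by blast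
qed

end

section \<open>Positivity of the kernel\<close>

lemma Hinf_ball_holomorphic: "b \<in> Hinf_ball \<Longrightarrow> b holomorphic_on upper_half_plane"
  by (simp add: Hinf_ball_def Hinf_def)

lemma Hinf_ball_norm_le:
  assumes "b \<in> Hinf_ball" "z \<in> upper_half_plane"
  shows "cmod (b z) \<le> 1"
proof -
  have "bounded (b ` upper_half_plane)" using assms(1) by (simp add: Hinf_ball_def Hinf_def)
  then have "bdd_above ((\<lambda>z. cmod (b z)) ` upper_half_plane)"
    unfolding bounded_iff bdd_above_def by auto
  then have "cmod (b z) \<le> Hinf_norm b"
    unfolding Hinf_norm_def using assms(2) by (intro cSUP_upper) auto
  then show ?thesis using assms(1) by (simp add: Hinf_ball_def)
qed

text \<open>
  The Szego kernel of the disc of centre \<open>c\<close> and radius \<open>r\<close> reproduces values of holomorphic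
  functions under integration over the boundary circle: this is the Cauchy formula.
\<close>

definition szego_kernel :: "complex \<Rightarrow> real \<Rightarrow> complex \<Rightarrow> complex \<Rightarrow> complex" where
  "szego_kernel c r w z = 1 / (of_real (r\<^sup>2) - (z - c) * cnj (w - c))"

lemma szego_denominator_nonzero:
  assumes "z \<in> cball c r" "w \<in> ball c r"
  shows "of_real (r\<^sup>2) - (z - c) * cnj (w - c) \<noteq> 0"
proof
  assume "of_real (r\<^sup>2) - (z - c) * cnj (w - c) = 0"
  then have "cmod ((z - c) * cnj (w - c)) = r\<^sup>2" by (metis eq_iff_diff_eq_0 norm_of_real abs_power2)
  then have eq: "cmod (z - c) * cmod (w - c) = r\<^sup>2" by (simp only: norm_mult complex_mod_cnj)
  have "cmod (z - c) \<le> r" "cmod (w - c) < r" using assms by (auto simp: dist_norm norm_minus_commute)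
  moreover from this have "0 < r" using norm_ge_zero[of "w - c"] by linarith
  ultimately have "cmod (z - c) * cmod (w - c) \<le> r * cmod (w - c)" "r * cmod (w - c) < r * r"
    by (simp_all add: mult_right_mono)
  with eq show False by (simp add: power2_eq_square)
qed

lemma szego_kernel_holomorphic:
  assumes "w \<in> ball c r"
  shows "szego_kernel c r w holomorphic_on cball c r"
  unfolding szego_kernel_def using szego_denominator_nonzero[OF _ assms]
  by (intro holomorphic_intros) auto

lemma szego_reproducing:
  assumes f: "f holomorphic_on cball c r" and w: "w \<in> ball c r"
  shows "((\<lambda>t. f (circlepath c r t) * cnj (szego_kernel c r w (circlepath c r t)))
    has_integral f w / of_real (r\<^sup>2)) {0..1}"
proof -
  have r: "0 < r" using w by (metis ball_eq_empty empty_iff not_le)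
  have "((\<lambda>u. f u / (u - w)) has_contour_integral (2 * of_real pi * \<i> * f w)) (circlepath c r)"
    using w by (intro Cauchy_integral_circlepath_simple[OF f]) (simp add: dist_norm norm_minus_commute)
  then have "((\<lambda>t. f (circlepath c r t) / (circlepath c r t - w) *
      vector_derivative (circlepath c r) (at t within {0..1})) has_integral
      (2 * of_real pi * \<i> * f w)) {0..1}"
    by (simp add: has_contour_integral_def)
  from has_integral_mult_right[OF this, of "1 / (2 * of_real pi * \<i> * of_real (r\<^sup>2))"]
  have "((\<lambda>t. 1 / (2 * of_real pi * \<i> * of_real (r\<^sup>2)) * (f (circlepath c r t) / (circlepath c r t - w) *
      vector_derivative (circlepath c r) (at t within {0..1}))) has_integral
      f w / of_real (r\<^sup>2)) {0..1}"
    by (simp add: field_simps)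
  then show ?thesis
  proof (rule has_integral_eq[rotated])
    fix t :: real assume t: "t \<in> {0..1}"
    define e where "e = exp (2 * of_real pi * \<i> * of_real t)"
    have ee: "e * cnj e = 1"
    proof -
      have "cmod e = 1" unfolding e_def
        using norm_exp_i_times[of "2 * pi * t"] by (simp add: mult_ac)
      then show ?thesis by (simp add: complex_norm_square[symmetric])
    qed
    have e0: "e \<noteq> 0" by (simp add: e_def)
    have z: "circlepath c r t = c + r * e" by (simp add: circlepath e_def)
    have zc: "circlepath c r t \<in> cball c r" using ee r
      by (auto simp: z dist_norm norm_mult e_def mult_ac norm_exp_i_times
          norm_exp_i_times[of "2 * pi * t", simplified mult_ac of_real_mult])
    have ne: "of_real (r\<^sup>2) - (circlepath c r t - c) * cnj (w - c) \<noteq> 0"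
      by (rule szego_denominator_nonzero[OF zc w])
    have "e * cnj (of_real (r\<^sup>2) - (circlepath c r t - c) * cnj (w - c))
        = e * of_real (r\<^sup>2) - r * (e * cnj e) * (w - c)"
      by (simp add: z algebra_simps)
    also have "\<dots> = r * (circlepath c r t - w)"
      by (simp add: ee z algebra_simps power2_eq_square)
    finally have "cnj (of_real (r\<^sup>2) - (circlepath c r t - c) * cnj (w - c))
        = r * (circlepath c r t - w) / e"
      using e0 by (simp add: field_simps)
    then have k: "cnj (szego_kernel c r w (circlepath c r t)) = e / (r * (circlepath c r t - w))"
      by (simp add: szego_kernel_def)
    have "vector_derivative (circlepath c r) (at t within {0..1}) = 2 * pi * \<i> * r * e"
      using t by (subst vector_derivative_circlepath01) (auto simp: e_def)
    then show "1 / (2 * of_real pi * \<i> * of_real (r\<^sup>2)) * (f (circlepath c r t) / (circlepath c r t - w) *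
        vector_derivative (circlepath c r) (at t within {0..1}))
      = f (circlepath c r t) * cnj (szego_kernel c r w (circlepath c r t))"
      unfolding k using r by (simp add: power2_eq_square field_simps)
  qed
qed

text \<open>
  With \<open>h = \<Sum> a\<^sub>i k\<^sub>i\<close> and \<open>g = \<Sum> a\<^sub>i \<psi>(w\<^sub>i)\<^sup>* k\<^sub>i\<close> (the image of \<open>h\<close> under the adjoint of
  multiplication by \<open>\<psi>\<close>), the quadratic form is \<open>\<parallel>h\<parallel>\<^sup>2 - \<parallel>g\<parallel>\<^sup>2\<close>. As \<open>\<langle>\<psi> g, h\<rangle> = \<parallel>g\<parallel>\<^sup>2\<close>, it is
  also \<open>\<parallel>h\<parallel>\<^sup>2 + \<parallel>g\<parallel>\<^sup>2 - 2 Re \<langle>\<psi> g, h\<rangle>\<close>, whose integrand is nonnegative.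
\<close>

lemma szego_pick_positive:
  fixes w :: "'i \<Rightarrow> complex" and a :: "'i \<Rightarrow> complex"
  assumes psi: "\<psi> holomorphic_on cball c r" and le1: "\<And>z. z \<in> cball c r \<Longrightarrow> cmod (\<psi> z) \<le> 1"
    and w: "\<And>i. i \<in> F \<Longrightarrow> w i \<in> ball c r" and F: "finite F" and r: "0 < r"
  shows "0 \<le> Re (\<Sum>i\<in>F. \<Sum>j\<in>F. a i * cnj (a j) *
      ((1 - cnj (\<psi> (w i)) * \<psi> (w j)) * szego_kernel c r (w i) (w j)))"
proof -
  define k where "k = (\<lambda>i. szego_kernel c r (w i))"
  define h where "h = (\<lambda>z. \<Sum>i\<in>F. a i * k i z)"
  define g where "g = (\<lambda>z. \<Sum>i\<in>F. a i * cnj (\<psi> (w i)) * k i z)"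
  have k: "k i holomorphic_on cball c r" if "i \<in> F" for i
    unfolding k_def by (rule szego_kernel_holomorphic[OF w[OF that]])
  have hol: "h holomorphic_on cball c r" "g holomorphic_on cball c r"
    unfolding h_def g_def using k by (auto intro!: holomorphic_intros)
  have rep: "((\<lambda>t. f (circlepath c r t) * cnj (\<Sum>j\<in>F. b j * k j (circlepath c r t)))
      has_integral (\<Sum>j\<in>F. cnj (b j) * f (w j)) / of_real (r\<^sup>2)) {0..1}"
    if f: "f holomorphic_on cball c r" for f b
  proof -
    have "((\<lambda>t. \<Sum>j\<in>F. cnj (b j) * (f (circlepath c r t) * cnj (k j (circlepath c r t))))
        has_integral (\<Sum>j\<in>F. cnj (b j) * (f (w j) / of_real (r\<^sup>2)))) {0..1}"
      unfolding k_def using w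
      by (intro has_integral_sum F has_integral_mult_right szego_reproducing f)
    then show ?thesis by (simp add: sum_distrib_left sum_divide_distrib mult_ac)
  qed
  have I1: "((\<lambda>t. h (circlepath c r t) * cnj (h (circlepath c r t)))
      has_integral (\<Sum>j\<in>F. cnj (a j) * h (w j)) / of_real (r\<^sup>2)) {0..1}"
    using rep[OF hol(1), of a] by (simp only: h_def)
  have I2: "((\<lambda>t. g (circlepath c r t) * cnj (g (circlepath c r t)))
      has_integral (\<Sum>j\<in>F. cnj (a j) * \<psi> (w j) * g (w j)) / of_real (r\<^sup>2)) {0..1}"
    using rep[OF hol(2), of "\<lambda>j. a j * cnj (\<psi> (w j))"] by (simp add: g_def)
  have I3: "((\<lambda>t. \<psi> (circlepath c r t) * g (circlepath c r t) * cnj (h (circlepath c r t)))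
      has_integral (\<Sum>j\<in>F. cnj (a j) * \<psi> (w j) * g (w j)) / of_real (r\<^sup>2)) {0..1}"
    using rep[OF holomorphic_on_mult[OF psi hol(2)], of a] by (simp add: h_def mult.assoc)
  define S1 where "S1 = (\<Sum>j\<in>F. cnj (a j) * h (w j))"
  define S2 where "S2 = (\<Sum>j\<in>F. cnj (a j) * \<psi> (w j) * g (w j))"
  have "((\<lambda>t. Re (h (circlepath c r t) * cnj (h (circlepath c r t))
        + g (circlepath c r t) * cnj (g (circlepath c r t))
        - 2 * (\<psi> (circlepath c r t) * g (circlepath c r t) * cnj (h (circlepath c r t)))))
      has_integral Re (S1 / of_real (r\<^sup>2) + S2 / of_real (r\<^sup>2) - 2 * (S2 / of_real (r\<^sup>2)))) {0..1}"
    unfolding S1_def S2_def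
    by (intro has_integral_Re has_integral_diff has_integral_add I1 I2 has_integral_mult_right I3)
  then have "0 \<le> Re (S1 / of_real (r\<^sup>2) + S2 / of_real (r\<^sup>2) - 2 * (S2 / of_real (r\<^sup>2)))"
  proof (rule has_integral_nonneg)
    fix t :: real assume t: "t \<in> {0..1}"
    define z where "z = circlepath c r t"
    have "z \<in> path_image (circlepath c r)" using t by (auto simp: z_def path_image_def)
    then have "cmod (\<psi> z) \<le> 1" using r by (intro le1) (auto simp: path_image_circlepath)
    then have "cmod (\<psi> z * g z * cnj (h z)) \<le> cmod (g z) * cmod (h z)"
      by (simp add: norm_mult mult_left_le_one_le mult_right_mono)
    moreover have "Re (\<psi> z * g z * cnj (h z)) \<le> cmod (\<psi> z * g z * cnj (h z))"
      by (rule complex_Re_le_cmod)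
    moreover have "0 \<le> (cmod (h z) - cmod (g z))\<^sup>2" by simp
    ultimately have "0 \<le> (cmod (h z))\<^sup>2 + (cmod (g z))\<^sup>2 - 2 * Re (\<psi> z * g z * cnj (h z))"
      by (simp add: power2_eq_square algebra_simps)
    moreover have "Re (u * cnj u) = (cmod u)\<^sup>2" for u
      by (simp only: complex_norm_square[symmetric] Re_complex_of_real)
    ultimately show "0 \<le> Re (h (circlepath c r t) * cnj (h (circlepath c r t))
        + g (circlepath c r t) * cnj (g (circlepath c r t))
        - 2 * (\<psi> (circlepath c r t) * g (circlepath c r t) * cnj (h (circlepath c r t))))"
      unfolding z_def[symmetric] by simp
  qed
  also have "S1 / of_real (r\<^sup>2) + S2 / of_real (r\<^sup>2) - 2 * (S2 / of_real (r\<^sup>2)) = (S1 - S2) / of_real (r\<^sup>2)"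
    by (simp add: diff_divide_distrib)
  also have "Re ((S1 - S2) / of_real (r\<^sup>2)) = Re (S1 - S2) / r\<^sup>2" by (rule Re_divide_of_real)
  finally have "0 \<le> Re (S1 - S2)" using r by (simp add: zero_le_divide_iff)
  also have "S1 - S2 = (\<Sum>j\<in>F. \<Sum>i\<in>F. a i * cnj (a j) *
      ((1 - cnj (\<psi> (w i)) * \<psi> (w j)) * szego_kernel c r (w i) (w j)))"
    unfolding S1_def S2_def h_def g_def k_def
    by (simp add: sum_distrib_left sum_subtractf[symmetric] algebra_simps)
  also have "\<dots> = (\<Sum>i\<in>F. \<Sum>j\<in>F. a i * cnj (a j) *
      ((1 - cnj (\<psi> (w i)) * \<psi> (w j)) * szego_kernel c r (w i) (w j)))"
    by (rule sum.swap)
  finally show ?thesis .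
qed

text \<open>
  The closed disc of radius \<open>r\<close> centred at \<open>\<i> (r + 1/r)\<close> lies in the open upper half-plane, and as
  \<open>r\<close> grows these discs absorb every point, while their rescaled kernels tend to that of the
  half-plane.
\<close>

lemma szego_kernel_limit:
  assumes "Im z > 0" "Im w > 0"
  shows "((\<lambda>r. of_real r * szego_kernel (\<i> * of_real (r + 1 / r)) r w z)
    \<longlongrightarrow> \<i> / (z - cnj w)) at_top"
proof -
  have ne: "z - cnj w \<noteq> 0" using assms by (auto simp: complex_eq_iff)
  have "((\<lambda>r::real. (- 2 - z * cnj w) * of_real (1 / r) - of_real (1 / r ^ 3)
      - \<i> * of_real (1 + 1 / r\<^sup>2) * (z - cnj w)) \<longlongrightarrow>
      (- 2 - z * cnj w) * of_real 0 - of_real 0 - \<i> * of_real 1 * (z - cnj w)) at_top"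
    by (intro tendsto_intros) real_asymp+
  then have "((\<lambda>r::real. 1 / ((- 2 - z * cnj w) * of_real (1 / r) - of_real (1 / r ^ 3)
      - \<i> * of_real (1 + 1 / r\<^sup>2) * (z - cnj w))) \<longlongrightarrow> 1 / (- \<i> * (z - cnj w))) at_top"
    using ne by (intro tendsto_divide tendsto_const) auto
  also have "1 / (- \<i> * (z - cnj w)) = \<i> / (z - cnj w)" using ne by (simp add: field_simps)
  finally show ?thesis
  proof (rule Lim_transform_eventually)
    show "\<forall>\<^sub>F r in at_top. 1 / ((- 2 - z * cnj w) * of_real (1 / r) - of_real (1 / r ^ 3)
      - \<i> * of_real (1 + 1 / r\<^sup>2) * (z - cnj w))
      = of_real r * szego_kernel (\<i> * of_real (r + 1 / r)) r w z"
      using eventually_gt_at_top[of "0::real"]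
    proof eventually_elim
      case (elim r)
      define R where "R = complex_of_real r"
      have R: "R \<noteq> 0" using elim by (simp add: R_def)
      have "R * ((- 2 - z * cnj w) * (1 / R) - 1 / R ^ 3 - \<i> * (1 + 1 / R\<^sup>2) * (z - cnj w))
          = R\<^sup>2 - (z - \<i> * (R + 1 / R)) * (cnj w + \<i> * (R + 1 / R))"
        using R by (simp add: field_simps power2_eq_square power3_eq_cube)
      then have "szego_kernel (\<i> * of_real (r + 1 / r)) r w z
          = 1 / (R * ((- 2 - z * cnj w) * (1 / R) - 1 / R ^ 3 - \<i> * (1 + 1 / R\<^sup>2) * (z - cnj w)))"
        by (simp add: szego_kernel_def R_def)
      then show ?case using R by (simp add: R_def)
    qed
  qed
qed

text \<open>
  Pick's theorem, in the direction that an analytic function bounded by 1 gives a positive kernel.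
\<close>

lemma dbr_kernel_positive:
  fixes w :: "'i \<Rightarrow> complex" and a :: "'i \<Rightarrow> complex"
  assumes b: "b \<in> Hinf_ball" and F: "finite F" and w: "\<And>i. i \<in> F \<Longrightarrow> w i \<in> upper_half_plane"
  shows "0 \<le> Re (\<Sum>i\<in>F. \<Sum>j\<in>F. a i * cnj (a j) * dbr_kernel b (w i) (w j))"
proof -
  define q where "q = (\<lambda>i j. a i * cnj (a j) * (1 - cnj (b (w i)) * b (w j)))"
  define Q where "Q = (\<lambda>r. \<Sum>i\<in>F. \<Sum>j\<in>F. q i j *
      (of_real r * szego_kernel (\<i> * of_real (r + 1 / r)) r (w i) (w j)))"
  have w0: "0 < Im (w i)" if "i \<in> F" for i using w[OF that] by (simp add: upper_half_plane_def)
  have "(Q \<longlongrightarrow> (\<Sum>i\<in>F. \<Sum>j\<in>F. q i j * (\<i> / (w j - cnj (w i))))) at_top"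
    unfolding Q_def using w0 by (intro tendsto_intros szego_kernel_limit) auto
  then have lim: "((\<lambda>r. Re (Q r)) \<longlongrightarrow> Re (\<Sum>i\<in>F. \<Sum>j\<in>F. q i j * (\<i> / (w j - cnj (w i))))) at_top"
    by (rule tendsto_Re)
  have in_ball: "\<forall>\<^sub>F r in at_top. w i \<in> ball (\<i> * of_real (r + 1 / r)) r" if "i \<in> F" for i
  proof -
    define x y where "x = Re (w i)" and "y = Im (w i)"
    have "y > 0" using w0[OF that] by (simp add: y_def)
    then have "\<forall>\<^sub>F r::real in at_top. x\<^sup>2 + (y - (r + 1 / r))\<^sup>2 < r\<^sup>2" by real_asymp
    then show ?thesis using eventually_gt_at_top[of "0::real"]
    proof eventually_elim
      case (elim r)
      have "(cmod (w i - \<i> * of_real (r + 1 / r)))\<^sup>2 < r\<^sup>2"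
        using elim(1) unfolding cmod_power2 by (simp add: x_def y_def)
      then show ?case using elim(2)
        by (simp add: dist_norm norm_minus_commute power_less_imp_less_base)
    qed
  qed
  have "\<forall>\<^sub>F r in at_top. \<forall>i\<in>F. w i \<in> ball (\<i> * of_real (r + 1 / r)) r"
    using F in_ball by (simp add: eventually_ball_finite_distrib)
  then have "\<forall>\<^sub>F r in at_top. 0 \<le> Re (Q r)" using eventually_gt_at_top[of "0::real"]
  proof eventually_elim
    case (elim r)
    define c where "c = \<i> * of_real (r + 1 / r)"
    have sub: "cball c r \<subseteq> upper_half_plane"
    proof
      fix z assume "z \<in> cball c r"
      then have "Im (c - z) \<le> r"
        using abs_Im_le_cmod[of "c - z"] by (simp add: dist_norm)
      then have "1 / r \<le> Im z" by (simp add: c_def)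
      moreover have "1 / r > 0" using elim(2) by simp
      ultimately have "0 < Im z" by linarith
      then show "z \<in> upper_half_plane" by (simp add: upper_half_plane_def)
    qed
    have "0 \<le> Re (\<Sum>i\<in>F. \<Sum>j\<in>F. a i * cnj (a j) *
      ((1 - cnj (b (w i)) * b (w j)) * szego_kernel c r (w i) (w j)))"
    proof (rule szego_pick_positive)
      show "w i \<in> ball c r" if "i \<in> F" for i using elim(1) that unfolding c_def by blast
      show "b holomorphic_on cball c r"
        by (rule holomorphic_on_subset[OF Hinf_ball_holomorphic[OF b] sub])
    qed (use sub F elim(2) in \<open>auto intro: Hinf_ball_norm_le[OF b]\<close>)
    then have "0 \<le> Re (of_real r * (\<Sum>i\<in>F. \<Sum>j\<in>F. a i * cnj (a j) *
      ((1 - cnj (b (w i)) * b (w j)) * szego_kernel c r (w i) (w j))))"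
      using elim(2) by simp
    then show ?case unfolding Q_def q_def c_def[symmetric] sum_distrib_left
      by (simp only: mult_ac)
  qed
  then have "0 \<le> Re (\<Sum>i\<in>F. \<Sum>j\<in>F. q i j * (\<i> / (w j - cnj (w i))))"
    by (intro tendsto_lowerbound[OF lim]) auto
  then have "0 \<le> 1 / (2 * pi) * Re (\<Sum>i\<in>F. \<Sum>j\<in>F. q i j * (\<i> / (w j - cnj (w i))))"
    by simp
  also have "\<dots> = Re (of_real (1 / (2 * pi)) * (\<Sum>i\<in>F. \<Sum>j\<in>F. q i j * (\<i> / (w j - cnj (w i)))))"
    unfolding times_complex.sel Re_complex_of_real Im_complex_of_real mult_zero_left diff_zero ..
  also have "of_real (1 / (2 * pi)) * (\<Sum>i\<in>F. \<Sum>j\<in>F. q i j * (\<i> / (w j - cnj (w i))))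
      = (\<Sum>i\<in>F. \<Sum>j\<in>F. a i * cnj (a j) * dbr_kernel b (w i) (w j))"
    unfolding sum_distrib_left using w
    by (intro sum.cong refl) (simp add: dbr_kernel_def q_def)
  finally show ?thesis .
qed

section \<open>Positive sesquilinear forms\<close>

lemma positive_form_entry_bound:
  fixes D :: "'i \<Rightarrow> 'i \<Rightarrow> complex"
  assumes herm: "\<And>i j. i \<in> I \<Longrightarrow> j \<in> I \<Longrightarrow> D j i = cnj (D i j)"
    and pos: "\<And>F a. finite F \<Longrightarrow> F \<subseteq> I \<Longrightarrow> 0 \<le> Re (\<Sum>i\<in>F. \<Sum>j\<in>F. a i * cnj (a j) * D i j)"
    and i: "i \<in> I" and j: "j \<in> I"
  shows "0 \<le> Re (D i i)" "(cmod (D i j))\<^sup>2 \<le> Re (D i i) * Re (D j j)"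
proof -
  have real: "Im (D k k) = 0" if "k \<in> I" for k
    using arg_cong[OF herm[OF that that], of Im] by simp
  show p: "0 \<le> Re (D i i)" using pos[of "{i}" "\<lambda>_. 1"] i by simp
  show "(cmod (D i j))\<^sup>2 \<le> Re (D i i) * Re (D j j)"
  proof (cases "i = j")
    case True
    then show ?thesis using real[OF i] by (simp add: cmod_power2) (simp add: power2_eq_square)
  next
    case False
    define w where "w = (cmod (D i j))\<^sup>2"
    have q: "0 \<le> t\<^sup>2 * Re (D i i) + w * Re (D j j) - 2 * t * w" for t :: real
    proof -
      have "0 \<le> Re (\<Sum>k\<in>{i, j}. \<Sum>m\<in>{i, j}. (if k = i then - of_real t else D i j) *
          cnj (if m = i then - of_real t else D i j) * D k m)"
        using i j by (intro pos) auto
      also have "\<dots> = t\<^sup>2 * Re (D i i) + w * Re (D j j) - 2 * t * w"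
        using False herm[OF i j] real[OF i] real[OF j] unfolding w_def cmod_power2
        by (simp add: power2_eq_square algebra_simps)
      finally show ?thesis .
    qed
    have "w \<ge> 0" by (simp add: w_def)
    show ?thesis
    proof (cases "w = 0")
      case True
      moreover have "0 \<le> Re (D j j)" using pos[of "{j}" "\<lambda>_. 1"] j by simp
      ultimately show ?thesis using p by (simp add: w_def)
    next
      case False
      then have w: "w > 0" using \<open>w \<ge> 0\<close> by simp
      have d: "Re (D i i) \<noteq> 0"
      proof
        assume 0: "Re (D i i) = 0"
        have "0 \<le> w * (Re (D j j) - 2 * (Re (D j j) + 1))"
          using q[of "Re (D j j) + 1"] 0 by (simp add: algebra_simps)
        moreover have "0 \<le> Re (D j j)" using pos[of "{j}" "\<lambda>_. 1"] j by simp
        ultimately show False using w by (simp add: zero_le_mult_iff)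
      qed
      \<comment> \<open>This \<open>t\<close> minimises the quadratic polynomial in \<open>q\<close>.\<close>
      have "0 \<le> (w / Re (D i i))\<^sup>2 * Re (D i i) + w * Re (D j j) - 2 * (w / Re (D i i)) * w"
        by (rule q)
      also have "\<dots> = w * (Re (D j j) - w / Re (D i i))"
        using d by (simp add: field_simps power2_eq_square)
      finally have "w / Re (D i i) \<le> Re (D j j)" using w by (simp add: zero_le_mult_iff)
      then show ?thesis using d p by (simp add: w_def[symmetric] field_simps)
    qed
  qed
qed

text \<open>A positive form is bounded by the square of the sum of the norms of its terms.\<close>

lemma positive_form_le:
  fixes D :: "'i \<Rightarrow> 'i \<Rightarrow> complex"
  assumes herm: "\<And>i j. i \<in> I \<Longrightarrow> j \<in> I \<Longrightarrow> D j i = cnj (D i j)"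
    and pos: "\<And>F a. finite F \<Longrightarrow> F \<subseteq> I \<Longrightarrow> 0 \<le> Re (\<Sum>i\<in>F. \<Sum>j\<in>F. a i * cnj (a j) * D i j)"
    and F: "finite F" "F \<subseteq> I"
  shows "Re (\<Sum>i\<in>F. \<Sum>j\<in>F. a i * cnj (a j) * D i j)
      \<le> (\<Sum>i\<in>F. cmod (a i) * sqrt (Re (D i i)))\<^sup>2"
proof -
  have "Re (\<Sum>i\<in>F. \<Sum>j\<in>F. a i * cnj (a j) * D i j)
      \<le> cmod (\<Sum>i\<in>F. \<Sum>j\<in>F. a i * cnj (a j) * D i j)" by (rule complex_Re_le_cmod)
  also have "\<dots> \<le> (\<Sum>i\<in>F. \<Sum>j\<in>F. (cmod (a i) * sqrt (Re (D i i))) * (cmod (a j) * sqrt (Re (D j j))))"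
  proof (intro sum_norm_le)
    fix i j assume "i \<in> F" "j \<in> F"
    then have ij: "i \<in> I" "j \<in> I" using F by auto
    have "cmod (D i j) \<le> sqrt (Re (D i i) * Re (D j j))"
      using positive_form_entry_bound(2)[OF herm pos ij] by (intro real_le_rsqrt) blast
    then have "cmod (a i) * cmod (a j) * cmod (D i j)
        \<le> cmod (a i) * cmod (a j) * sqrt (Re (D i i) * Re (D j j))"
      by (intro mult_left_mono) auto
    then show "cmod (a i * cnj (a j) * D i j)
        \<le> (cmod (a i) * sqrt (Re (D i i))) * (cmod (a j) * sqrt (Re (D j j)))"
      by (simp add: norm_mult real_sqrt_mult mult_ac)
  qed
  also have "\<dots> = (\<Sum>i\<in>F. cmod (a i) * sqrt (Re (D i i)))\<^sup>2"
    by (simp add: power2_eq_square sum_product)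
  finally show ?thesis .
qed


section \<open>Kernel combinations in the two spaces\<close>

context de_branges_rovnyak_space
begin

lemma iprod_kernels:
  assumes "w \<in> upper_half_plane" "v \<in> upper_half_plane"
  shows "iprod H (dbr_kernel b w) (dbr_kernel b v) = dbr_kernel b w v"
  using reproducing[OF kernel_closed[OF assms(1)] assms(2)] by simp

lemma kernel_hermitian:
  assumes "w \<in> upper_half_plane" "v \<in> upper_half_plane"
  shows "dbr_kernel b v w = cnj (dbr_kernel b w v)"
  using iprod_commute[OF kernel_closed[OF assms(1)] kernel_closed[OF assms(2)]]
  by (simp add: iprod_kernels assms)

lemma iprod_kernel_left:
  assumes "f \<in> Elts H" "w \<in> upper_half_plane"
  shows "iprod H (dbr_kernel b w) f = cnj (f w)"
  using iprod_commute[OF assms(1) kernel_closed[OF assms(2)]] reproducing[OF assms] by simp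

lemma normalized_kernel_alt:
  "normalized_kernel b H w = (\<lambda>z. 1 / of_real (hnorm H (dbr_kernel b w)) * dbr_kernel b w z)"
  by (simp add: normalized_kernel_def)

lemma normalized_kernel_closed:
  "w \<in> upper_half_plane \<Longrightarrow> normalized_kernel b H w \<in> Elts H"
  unfolding normalized_kernel_alt by (intro scale_closed kernel_closed)

lemma iprod_normalized_kernel_left:
  assumes "f \<in> Elts H" "w \<in> upper_half_plane"
  shows "iprod H (normalized_kernel b H w) f = cnj (f w) / of_real (hnorm H (dbr_kernel b w))"
  unfolding normalized_kernel_alt iprod_scale_left[OF kernel_closed[OF assms(2)] assms(1)]
  by (simp add: assms iprod_kernel_left)

lemma vanishes_at_degenerate_point:
  assumes "f \<in> Elts H" "w \<in> upper_half_plane" "hnorm H (dbr_kernel b w) = 0"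
  shows "f w = 0"
proof -
  have "dbr_kernel b w = (\<lambda>z. 0)" using hnorm_eq_zeroD kernel_closed assms by blast
  then have "cnj (f w) = 0"
    using iprod_kernel_left[OF assms(1,2)] iprod_zero_left[OF assms(1)] by simp
  then show ?thesis by simp
qed

text \<open>Completeness follows once the points form a set of uniqueness for the space.\<close>

lemma complete_if_uniqueness_set:
  assumes l: "\<And>n. n \<ge> p \<Longrightarrow> l n \<in> upper_half_plane"
    and uniq: "\<And>f. f \<in> Elts H \<Longrightarrow> (\<And>n. n \<ge> p \<Longrightarrow> f (l n) = 0) \<Longrightarrow> f = (\<lambda>z. 0)"
  shows "complete_seq H p (\<lambda>n. normalized_kernel b H (l n))"
proof -
  define x where "x = (\<lambda>n. normalized_kernel b H (l n))"
  have x: "x n \<in> Elts H" if "n \<ge> p" for n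
    unfolding x_def using l[OF that] by (rule normalized_kernel_closed)
  have "f \<in> norm_closure H (lin_span (x ` {p..}))" if f: "f \<in> Elts H" for f
  proof -
    have "\<exists>G \<in> norm_closure H (lin_span (x ` {p..})). \<forall>n\<in>{p..}. iprod H (x n) G = iprod H (x n) f"
    proof (rule moment_problem[where C = "hnorm H f"])
      fix F a assume "finite F" "F \<subseteq> {p..}"
      then have F: "\<And>n. n \<in> F \<Longrightarrow> x n \<in> Elts H" using x by auto
      show "cmod (\<Sum>n\<in>F. a n * iprod H (x n) f) \<le> hnorm H f * hnorm H (\<lambda>z. \<Sum>n\<in>F. a n * x n z)"
        using hilbert_cauchy_schwarz[OF sum_closed[of F x a, OF F] f]
        by (simp add: iprod_sum_left[OF F f] mult.commute)
    qed (use x in auto)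
    then obtain G where G: "G \<in> norm_closure H (lin_span (x ` {p..}))"
      and eq: "\<And>n. n \<ge> p \<Longrightarrow> iprod H (x n) G = iprod H (x n) f" by auto
    have GE: "G \<in> Elts H" using G by (simp add: norm_closure_def)
    have "(\<lambda>z. f z - G z) = (\<lambda>z. 0)"
    proof (rule uniq[OF diff_closed[OF f GE]])
      fix n assume n: "n \<ge> p"
      show "f (l n) - G (l n) = 0"
      proof (cases "hnorm H (dbr_kernel b (l n)) = 0")
        case True
        then show ?thesis
          using vanishes_at_degenerate_point[OF f l[OF n]] vanishes_at_degenerate_point[OF GE l[OF n]]
          by simp
      next
        case False
        then have "cnj (G (l n)) = cnj (f (l n))"
          using eq[OF n] unfolding x_def iprod_normalized_kernel_left[OF f l[OF n]]
            iprod_normalized_kernel_left[OF GE l[OF n]] by simp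
        then show ?thesis by simp
      qed
    qed
    then have "f = G" by (auto simp: fun_eq_iff)
    then show ?thesis using G by simp
  qed
  then show ?thesis unfolding complete_seq_def x_def norm_closure_def by blast
qed

end

text \<open>
  A factorisation \<open>b\<^sub>1 = b\<^sub>2 b\<close>. The difference of the two kernels is the positive kernel
  \<open>b\<^sub>2(w)\<^sup>* b\<^sub>2(z) k\<^sup>b\<^sub>w(z)\<close>, called the defect below.
\<close>

locale dbr_factorisation =
  S1: de_branges_rovnyak_space b1 H1 + S2: de_branges_rovnyak_space b2 H2
  for b1 b2 b :: "complex \<Rightarrow> complex" and H1 H2 :: "complex fun_space" +
  assumes b_ball: "b \<in> Hinf_ball"
    and factor: "z \<in> upper_half_plane \<Longrightarrow> b1 z = b2 z * b z"
begin

definition defect :: "complex \<Rightarrow> complex \<Rightarrow> complex" where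
  "defect w z = cnj (b2 w) * b2 z * dbr_kernel b w z"

lemma kernel_split:
  assumes "w \<in> upper_half_plane"
  shows "dbr_kernel b1 w z = dbr_kernel b2 w z + defect w z"
proof (cases "z \<in> upper_half_plane")
  case True
  have e: "1 - cnj (b1 w) * b1 z = (1 - cnj (b2 w) * b2 z) + cnj (b2 w) * b2 z * (1 - cnj (b w) * b z)"
    by (simp add: factor True assms algebra_simps)
  show ?thesis using True
    by (simp only: dbr_kernel_def defect_def e if_True add_divide_distrib distrib_left)
      (simp add: mult_ac)
qed (simp add: dbr_kernel_def defect_def)

lemma defect_hermitian:
  assumes "w \<in> upper_half_plane" "v \<in> upper_half_plane"
  shows "defect v w = cnj (defect w v)"
  using S1.kernel_hermitian[OF assms] S2.kernel_hermitian[OF assms]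
    kernel_split[OF assms(1), of v] kernel_split[OF assms(2), of w] by simp

lemma defect_diagonal:
  assumes "w \<in> upper_half_plane"
  shows "Re (defect w w) = (hnorm H1 (dbr_kernel b1 w))\<^sup>2 - (hnorm H2 (dbr_kernel b2 w))\<^sup>2"
  using kernel_split[OF assms, of w] assms
  by (simp add: S1.hnorm_sq S2.hnorm_sq S1.kernel_closed S2.kernel_closed
      S1.iprod_kernels S2.iprod_kernels)

lemma defect_positive:
  assumes "finite F" "\<And>i. i \<in> F \<Longrightarrow> w i \<in> upper_half_plane"
  shows "0 \<le> Re (\<Sum>i\<in>F. \<Sum>j\<in>F. a i * cnj (a j) * defect (w i) (w j))"
  using dbr_kernel_positive[OF b_ball assms(1), of w "\<lambda>i. a i * cnj (b2 (w i))"] assms(2)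
  by (simp add: defect_def mult_ac)

lemma kernel_norm_le:
  assumes "w \<in> upper_half_plane"
  shows "(hnorm H2 (dbr_kernel b2 w))\<^sup>2 \<le> (hnorm H1 (dbr_kernel b1 w))\<^sup>2"
  using defect_positive[of "{0::nat}" "\<lambda>_. w" "\<lambda>_. 1"] assms by (simp add: defect_diagonal)

lemma combination_norms:
  assumes w: "\<And>i. i \<in> F \<Longrightarrow> w i \<in> upper_half_plane"
  shows "(hnorm H1 (\<lambda>z. \<Sum>i\<in>F. a i * dbr_kernel b1 (w i) z))\<^sup>2
    = (hnorm H2 (\<lambda>z. \<Sum>i\<in>F. a i * dbr_kernel b2 (w i) z))\<^sup>2
      + Re (\<Sum>i\<in>F. \<Sum>j\<in>F. a i * cnj (a j) * defect (w i) (w j))"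
proof -
  have "(\<Sum>i\<in>F. \<Sum>j\<in>F. a i * cnj (a j) * dbr_kernel b1 (w i) (w j))
      = (\<Sum>i\<in>F. \<Sum>j\<in>F. a i * cnj (a j) * dbr_kernel b2 (w i) (w j))
        + (\<Sum>i\<in>F. \<Sum>j\<in>F. a i * cnj (a j) * defect (w i) (w j))"
    unfolding sum.distrib[symmetric] using w
    by (intro sum.cong refl) (simp add: kernel_split distrib_left)
  moreover have "(hnorm H1 (\<lambda>z. \<Sum>i\<in>F. a i * dbr_kernel b1 (w i) z))\<^sup>2
      = Re (\<Sum>i\<in>F. \<Sum>j\<in>F. a i * cnj (a j) * dbr_kernel b1 (w i) (w j))"
    using w by (subst S1.hnorm_sum_sq) (auto simp: S1.kernel_closed S1.iprod_kernels)
  moreover have "(hnorm H2 (\<lambda>z. \<Sum>i\<in>F. a i * dbr_kernel b2 (w i) z))\<^sup>2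
      = Re (\<Sum>i\<in>F. \<Sum>j\<in>F. a i * cnj (a j) * dbr_kernel b2 (w i) (w j))"
    using w by (subst S2.hnorm_sum_sq) (auto simp: S2.kernel_closed S2.iprod_kernels)
  ultimately show ?thesis by simp
qed

text \<open>
  For coefficients \<open>a i / d i\<close> the defect form is bounded by \<open>\<Sum> |a i|\<^sup>2\<close> times the trace of its
  rescaled matrix. If \<open>d i\<close> is the norm of a kernel function, the trace is controlled by the sum of
  the numbers \<open>|R i - 1|\<close>, with \<open>R i\<close> the kernel ratio.
\<close>

lemma defect_trace_bound:
  assumes F: "finite F" and w: "\<And>i. i \<in> F \<Longrightarrow> w i \<in> upper_half_plane"
    and d: "\<And>i. i \<in> F \<Longrightarrow> 0 < d i"
  shows "Re (\<Sum>i\<in>F. \<Sum>j\<in>F. (a i / of_real (d i)) * cnj (a j / of_real (d j)) * defect (w i) (w j))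
    \<le> (\<Sum>i\<in>F. (cmod (a i))\<^sup>2) *
      (\<Sum>i\<in>F. ((hnorm H1 (dbr_kernel b1 (w i)))\<^sup>2 - (hnorm H2 (dbr_kernel b2 (w i)))\<^sup>2) / (d i)\<^sup>2)"
proof -
  define t where "t = (\<lambda>i. Re (defect (w i) (w i)) / (d i)\<^sup>2)"
  have t0: "0 \<le> t i" if "i \<in> F" for i
    using kernel_norm_le[OF w[OF that]] defect_diagonal[OF w[OF that]] by (simp add: t_def)
  have "Re (\<Sum>i\<in>F. \<Sum>j\<in>F. (a i / of_real (d i)) * cnj (a j / of_real (d j)) * defect (w i) (w j))
      \<le> (\<Sum>i\<in>F. cmod (a i / of_real (d i)) * sqrt (Re (defect (w i) (w i))))\<^sup>2"
  proof (rule positive_form_le[where I = F])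
    show "defect (w j) (w i) = cnj (defect (w i) (w j))" if "i \<in> F" "j \<in> F" for i j
      using that w by (intro defect_hermitian) auto
    show "0 \<le> Re (\<Sum>i\<in>F'. \<Sum>j\<in>F'. c i * cnj (c j) * defect (w i) (w j))"
      if "finite F'" "F' \<subseteq> F" for F' c
      using that w by (intro defect_positive) auto
  qed (use F in auto)
  also have "\<dots> = (\<Sum>i\<in>F. cmod (a i) * sqrt (t i))\<^sup>2"
    using d by (intro arg_cong[where f = power2] sum.cong refl)
      (simp add: t_def norm_divide real_sqrt_divide)
  also have "\<dots> \<le> (\<Sum>i\<in>F. (cmod (a i))\<^sup>2) * (\<Sum>i\<in>F. (sqrt (t i))\<^sup>2)"
    by (rule Cauchy_Schwarz_ineq_sum)
  also have "(\<Sum>i\<in>F. (sqrt (t i))\<^sup>2) = (\<Sum>i\<in>F.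
      ((hnorm H1 (dbr_kernel b1 (w i)))\<^sup>2 - (hnorm H2 (dbr_kernel b2 (w i)))\<^sup>2) / (d i)\<^sup>2)"
    using t0 w by (intro sum.cong refl) (simp add: t_def defect_diagonal)
  finally show ?thesis .
qed

text \<open>
  The map sending \<open>k\<^sup>1\<^sub>w\<close> to \<open>k\<^sup>2\<^sub>w\<close> is a contraction, so approximations of \<open>k\<^sup>1\<^sub>\<mu>\<close> by combinations of
  the given kernels turn into approximations of \<open>k\<^sup>2\<^sub>\<mu>\<close>.
\<close>

lemma uniqueness_set_if_complete:
  assumes l: "\<And>n. n \<ge> 1 \<Longrightarrow> l n \<in> upper_half_plane"
    and compl: "complete_seq H1 1 (\<lambda>n. normalized_kernel b1 H1 (l n))"
    and f: "f \<in> Elts H2" and zero: "\<And>n. n \<ge> 1 \<Longrightarrow> f (l n) = 0"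
  shows "f = (\<lambda>z. 0)"
proof
  fix \<mu>
  show "f \<mu> = 0"
  proof (cases "\<mu> \<in> upper_half_plane")
    case True
    have "cmod (f \<mu>) \<le> hnorm H2 f * e" if e: "e > 0" for e
    proof -
      have "dbr_kernel b1 \<mu> \<in> norm_closure H1 (lin_span ((\<lambda>n. normalized_kernel b1 H1 (l n)) ` {1..}))"
        using compl S1.kernel_closed[OF True] by (simp add: complete_seq_def)
      then obtain F a where F: "finite F" "F \<subseteq> {1..}" and
        app: "hnorm H1 (\<lambda>z. dbr_kernel b1 \<mu> z - (\<Sum>n\<in>F. a n * normalized_kernel b1 H1 (l n) z)) < e"
        using e unfolding norm_closure_def S1.lin_span_image by blast
      \<comment> \<open>The index \<open>0\<close> is free and is given to the point \<open>\<mu>\<close>.\<close>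
      define w where "w = l(0 := \<mu>)"
      define A where "A = (\<lambda>n. if n = 0 then 1 else - a n / of_real (hnorm H1 (dbr_kernel b1 (l n))))"
      have F0: "0 \<notin> F" using F(2) by auto
      have w: "w i \<in> upper_half_plane" if "i \<in> insert 0 F" for i
        using that l F(2) True by (auto simp: w_def)
      have wA: "w n = l n" "A n = - a n / of_real (hnorm H1 (dbr_kernel b1 (l n)))" if "n \<in> F" for n
        using that F0 by (auto simp: w_def A_def)
      have w0: "w 0 = \<mu>" "A 0 = 1" by (simp_all add: w_def A_def)
      have "(\<lambda>z. dbr_kernel b1 \<mu> z - (\<Sum>n\<in>F. a n * normalized_kernel b1 H1 (l n) z))
          = (\<lambda>z. \<Sum>i\<in>insert 0 F. A i * dbr_kernel b1 (w i) z)"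
        using F(1) F0 by (simp add: w0 wA normalized_kernel_def sum_negf fun_eq_iff)
      with app have "hnorm H1 (\<lambda>z. \<Sum>i\<in>insert 0 F. A i * dbr_kernel b1 (w i) z) < e" by simp
      then have "(hnorm H1 (\<lambda>z. \<Sum>i\<in>insert 0 F. A i * dbr_kernel b1 (w i) z))\<^sup>2 < e\<^sup>2"
        using w by (intro power_strict_mono S1.hnorm_nonneg S1.sum_closed S1.kernel_closed) auto
      moreover define h where "h = (\<lambda>z. \<Sum>i\<in>insert 0 F. A i * dbr_kernel b2 (w i) z)"
      ultimately have "(hnorm H2 h)\<^sup>2 < e\<^sup>2"
        using combination_norms[of "insert 0 F" w A, OF w]
          defect_positive[of "insert 0 F" w A, OF _ w] F(1) by simp
      then have he: "hnorm H2 h \<le> e" using e by (intro less_imp_le) (simp add: power_less_imp_less_base)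
      have hE: "h \<in> Elts H2" unfolding h_def using w
        by (intro S2.sum_closed S2.kernel_closed) auto
      have "iprod H2 f h = (\<Sum>i\<in>insert 0 F. cnj (A i) * iprod H2 f (dbr_kernel b2 (w i)))"
        unfolding h_def using w by (intro S2.iprod_sum_right f S2.kernel_closed) auto
      also have "\<dots> = (\<Sum>i\<in>insert 0 F. cnj (A i) * f (w i))"
        using w by (intro sum.cong refl) (simp add: S2.reproducing[OF f])
      also have "\<dots> = f \<mu>" using F F0 zero by (simp add: w0) (intro sum.neutral, auto simp: wA)
      finally show ?thesis
        using S2.hilbert_cauchy_schwarz[OF f hE] mult_left_mono[OF he S2.hnorm_nonneg[OF f]] by simp
    qed
    from this[of "inverse (Suc n)" for n] have "cmod (f \<mu>) \<le> hnorm H2 f * inverse (real (Suc n))" for n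
      by simp
    then have "cmod (f \<mu>) \<le> hnorm H2 f * 0"
      by (intro LIMSEQ_le_const[OF tendsto_mult[OF tendsto_const LIMSEQ_inverse_real_of_nat]]) auto
    then show ?thesis by simp
  qed (rule S2.vanish_outside[OF f])
qed

end

section \<open>Riesz bounds\<close>

text \<open>
  The two-sided estimate in the definition of an asymptotically orthonormal sequence, for one
  starting index \<open>N\<close>. Coefficients live on an arbitrary finite set of indices, which is more
  convenient than the exact support.
\<close>

definition riesz_bounds :: "'a fun_space \<Rightarrow> (nat \<Rightarrow> 'a \<Rightarrow> complex) \<Rightarrow> nat \<Rightarrow> real \<Rightarrow> real \<Rightarrow> bool" where
  "riesz_bounds H x N c C \<longleftrightarrow> 0 < c \<and> 0 < C \<and>
    (\<forall>F a. finite F \<longrightarrow> F \<subseteq> {N..} \<longrightarrow>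
      c * (\<Sum>n\<in>F. (cmod (a n))\<^sup>2) \<le> (hnorm H (\<lambda>z. \<Sum>n\<in>F. a n * x n z))\<^sup>2 \<and>
      (hnorm H (\<lambda>z. \<Sum>n\<in>F. a n * x n z))\<^sup>2 \<le> C * (\<Sum>n\<in>F. (cmod (a n))\<^sup>2))"

lemma riesz_boundsD:
  assumes "riesz_bounds H x N c C" "finite F" "F \<subseteq> {N..}"
  shows "c * (\<Sum>n\<in>F. (cmod (a n))\<^sup>2) \<le> (hnorm H (\<lambda>z. \<Sum>n\<in>F. a n * x n z))\<^sup>2"
    "(hnorm H (\<lambda>z. \<Sum>n\<in>F. a n * x n z))\<^sup>2 \<le> C * (\<Sum>n\<in>F. (cmod (a n))\<^sup>2)"
  using assms unfolding riesz_bounds_def by blast+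

lemma riesz_bounds_iff:
  "riesz_bounds H x N c C \<longleftrightarrow> 0 < c \<and> 0 < C \<and>
    (\<forall>a. finite {n. a n \<noteq> 0} \<longrightarrow>
      c * (\<Sum>n | N \<le> n \<and> a n \<noteq> 0. (cmod (a n))\<^sup>2)
        \<le> (hnorm H (\<lambda>z. \<Sum>n | N \<le> n \<and> a n \<noteq> 0. a n * x n z))\<^sup>2 \<and>
      (hnorm H (\<lambda>z. \<Sum>n | N \<le> n \<and> a n \<noteq> 0. a n * x n z))\<^sup>2
        \<le> C * (\<Sum>n | N \<le> n \<and> a n \<noteq> 0. (cmod (a n))\<^sup>2))"
  (is "?L \<longleftrightarrow> 0 < c \<and> 0 < C \<and> (\<forall>a. finite {n. a n \<noteq> 0} \<longrightarrow> ?P a)")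
proof
  assume L: ?L
  have "?P a" if "finite {n. a n \<noteq> 0}" for a
  proof -
    have "finite {n. N \<le> n \<and> a n \<noteq> 0}" by (rule finite_subset[OF _ that]) auto
    moreover have "{n. N \<le> n \<and> a n \<noteq> 0} \<subseteq> {N..}" by auto
    ultimately show ?thesis using riesz_boundsD[OF L] by blast
  qed
  then show "0 < c \<and> 0 < C \<and> (\<forall>a. finite {n. a n \<noteq> 0} \<longrightarrow> ?P a)"
    using L by (simp add: riesz_bounds_def)
next
  assume R: "0 < c \<and> 0 < C \<and> (\<forall>a. finite {n. a n \<noteq> 0} \<longrightarrow> ?P a)"
  have "c * (\<Sum>n\<in>F. (cmod (a n))\<^sup>2) \<le> (hnorm H (\<lambda>z. \<Sum>n\<in>F. a n * x n z))\<^sup>2 \<and>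
      (hnorm H (\<lambda>z. \<Sum>n\<in>F. a n * x n z))\<^sup>2 \<le> C * (\<Sum>n\<in>F. (cmod (a n))\<^sup>2)"
    if F: "finite F" "F \<subseteq> {N..}" for F a
  proof -
    define a' where "a' = (\<lambda>n. if n \<in> F then a n else 0)"
    have "finite {n. a' n \<noteq> 0}" by (rule finite_subset[OF _ F(1)]) (auto simp: a'_def)
    then have P: "?P a'" using R by blast
    have sub: "{n. N \<le> n \<and> a' n \<noteq> 0} \<subseteq> F" by (auto simp: a'_def)
    have s1: "(\<Sum>n | N \<le> n \<and> a' n \<noteq> 0. (cmod (a' n))\<^sup>2) = (\<Sum>n\<in>F. (cmod (a n))\<^sup>2)"
      using F sub by (intro sum.mono_neutral_cong_left) (auto simp: a'_def)
    have s2: "(\<Sum>n | N \<le> n \<and> a' n \<noteq> 0. a' n * x n z) = (\<Sum>n\<in>F. a n * x n z)" for z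
      using F sub by (intro sum.mono_neutral_cong_left) (auto simp: a'_def)
    show ?thesis using P unfolding s1 s2 .
  qed
  then show ?L using R unfolding riesz_bounds_def by blast
qed

lemma AOB_iff_riesz_bounds:
  "AOB H p x \<longleftrightarrow> (\<forall>n\<ge>p. x n \<in> Elts H) \<and>
    (\<exists>c C. (\<forall>N\<ge>p. riesz_bounds H x N (c N) (C N)) \<and> c \<longlonglongrightarrow> 1 \<and> C \<longlonglongrightarrow> 1)"
  unfolding AOB_def riesz_bounds_iff ..

context hilbert_function_space
begin

lemma riesz_bounds_nonzero:
  assumes "riesz_bounds H x N c C" "n \<ge> N"
  shows "x n \<noteq> (\<lambda>z. 0)"
proof
  assume "x n = (\<lambda>z. 0)"
  then have "c \<le> 0"
    using riesz_boundsD(1)[OF assms(1), of "{n}" "\<lambda>_. 1"] assms(2) by (simp add: hnorm_zero)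
  then show False using assms(1) by (simp add: riesz_bounds_def)
qed

lemma riesz_bounds_inj:
  assumes "riesz_bounds H x N c C"
  shows "inj_on x {N..}"
proof (rule inj_onI, rule ccontr)
  fix m n assume mn: "m \<in> {N..}" "n \<in> {N..}" "x m = x n" "m \<noteq> n"
  have "c * 2 \<le> 0"
    using riesz_boundsD(1)[OF assms, of "{m, n}" "\<lambda>i. if i = m then 1 else - 1"] mn
    by (simp add: hnorm_zero)
  then show False using assms by (simp add: riesz_bounds_def)
qed

lemma riesz_bounds_not_in_closure:
  assumes rb: "riesz_bounds H x N c C" and x: "\<And>n. n \<ge> N \<Longrightarrow> x n \<in> Elts H"
  shows "x N \<notin> norm_closure H (lin_span (x ` {Suc N..}))"
proof
  assume "x N \<in> norm_closure H (lin_span (x ` {Suc N..}))"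
  moreover have c: "c > 0" using rb by (simp add: riesz_bounds_def)
  ultimately obtain F a where F: "finite F" "F \<subseteq> {Suc N..}"
    and lt: "hnorm H (\<lambda>z. x N z - (\<Sum>n\<in>F. a n * x n z)) < sqrt c" and xN: "x N \<in> Elts H"
    unfolding norm_closure_def lin_span_image using real_sqrt_gt_zero[OF c] by blast
  define A where "A = (\<lambda>n. if n = N then 1 else - a n)"
  have NF: "N \<notin> F" using F(2) by auto
  have FN: "insert N F \<subseteq> {N..}" using subset_trans[OF F(2), of "{N..}"] by auto
  have "(\<Sum>n\<in>insert N F. A n * x n z) = x N z - (\<Sum>n\<in>F. a n * x n z)" for z
  proof -
    have "(\<Sum>n\<in>F. A n * x n z) = (\<Sum>n\<in>F. - (a n * x n z))"
      using NF by (intro sum.cong refl) (auto simp: A_def)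
    then show ?thesis using F(1) NF by (simp add: A_def sum_negf)
  qed
  then have "c * (\<Sum>n\<in>insert N F. (cmod (A n))\<^sup>2)
      \<le> (hnorm H (\<lambda>z. x N z - (\<Sum>n\<in>F. a n * x n z)))\<^sup>2"
    using riesz_boundsD(1)[OF rb _ FN, of A] F(1) by simp
  also have "\<dots> < (sqrt c)\<^sup>2"
  proof (rule power_strict_mono[OF lt])
    have "x n \<in> Elts H" if "n \<in> F" for n using x FN that by auto
    then show "0 \<le> hnorm H (\<lambda>z. x N z - (\<Sum>n\<in>F. a n * x n z))"
      by (intro hnorm_nonneg diff_closed xN sum_closed)
  qed simp
  also have "(sqrt c)\<^sup>2 = c" using c by simp
  finally have "(\<Sum>n\<in>insert N F. (cmod (A n))\<^sup>2) < 1" using c by simp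
  moreover have "(\<Sum>n\<in>insert N F. (cmod (A n))\<^sup>2) = 1 + (\<Sum>n\<in>F. (cmod (A n))\<^sup>2)"
    using F(1) NF by (simp add: A_def)
  ultimately show False using sum_nonneg[of F "\<lambda>n. (cmod (A n))\<^sup>2"] by simp
qed

text \<open>
  A vector that is detected by some \<open>g\<close> orthogonal to all later members may be put in front
  of the sequence.
\<close>

lemma riesz_bounds_prepend:
  assumes rb: "riesz_bounds H x (Suc N) c C" and x: "\<And>n. n \<ge> N \<Longrightarrow> x n \<in> Elts H"
    and g: "g \<in> Elts H" and gN: "iprod H (x N) g \<noteq> 0" and g0: "\<And>n. n > N \<Longrightarrow> iprod H (x n) g = 0"
  shows "\<exists>c' C'. riesz_bounds H x N c' C'"
proof -
  define G where "G = (hnorm H g)\<^sup>2 / (cmod (iprod H (x N) g))\<^sup>2"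
  define X where "X = (hnorm H (x N))\<^sup>2"
  define M where "M = G + (2 + 2 * G * X) / c"
  define M' where "M' = 2 * X + 2 * C"
  have c: "c > 0" "C > 0" using rb by (auto simp: riesz_bounds_def)
  have GX: "G \<ge> 0" "X \<ge> 0" by (auto simp: G_def X_def)
  have "2 + 2 * G * X > 0" using GX by (intro add_pos_nonneg) auto
  then have M: "M > 0" "M' > 0"
    unfolding M_def M'_def using c GX by (auto intro: add_nonneg_pos)
  have "(1 / M) * (\<Sum>n\<in>F. (cmod (a n))\<^sup>2) \<le> (hnorm H (\<lambda>z. \<Sum>n\<in>F. a n * x n z))\<^sup>2 \<and>
      (hnorm H (\<lambda>z. \<Sum>n\<in>F. a n * x n z))\<^sup>2 \<le> M' * (\<Sum>n\<in>F. (cmod (a n))\<^sup>2)"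
    if F: "finite F" "F \<subseteq> {N..}" for F a
  proof -
    define \<alpha> where "\<alpha> = (if N \<in> F then a N else 0)"
    define h where "h = (\<lambda>z. \<Sum>n\<in>F - {N}. a n * x n z)"
    define S where "S = (\<Sum>n\<in>F - {N}. (cmod (a n))\<^sup>2)"
    define u where "u = (\<lambda>z. \<Sum>n\<in>F. a n * x n z)"
    have FN: "F - {N} \<subseteq> {Suc N..}" using F(2) by (auto simp: Suc_le_eq le_less)
    have hE: "h \<in> Elts H" unfolding h_def using F x by (intro sum_closed) auto
    have aE: "(\<lambda>z. \<alpha> * x N z) \<in> Elts H" using x by (intro scale_closed) auto
    have uE: "u \<in> Elts H" unfolding u_def using F x by (intro sum_closed) auto
    have u: "u = (\<lambda>z. \<alpha> * x N z + h z)"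
      unfolding u_def h_def \<alpha>_def using F(1) by (auto simp: sum.remove fun_eq_iff)
    have h: "h = (\<lambda>z. u z - \<alpha> * x N z)" by (simp add: u)
    have S: "(\<Sum>n\<in>F. (cmod (a n))\<^sup>2) = (cmod \<alpha>)\<^sup>2 + S"
      unfolding S_def \<alpha>_def using F(1) by (auto simp: sum.remove)
    have hb: "c * S \<le> (hnorm H h)\<^sup>2" "(hnorm H h)\<^sup>2 \<le> C * S"
      unfolding h_def S_def using riesz_boundsD[OF rb _ FN, of a] F(1) by auto
    have ab: "(hnorm H (\<lambda>z. \<alpha> * x N z))\<^sup>2 = (cmod \<alpha>)\<^sup>2 * X"
      unfolding X_def using x by (intro hnorm_scale_sq) auto
    have S0: "S \<ge> 0" by (simp add: S_def sum_nonneg)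
    have "iprod H u g = (\<Sum>n\<in>F. a n * iprod H (x n) g)"
      unfolding u_def using F x g by (intro iprod_sum_left) auto
    also have "\<dots> = (\<Sum>n\<in>F. if n = N then a N * iprod H (x N) g else 0)"
      using F(2) g0 by (intro sum.cong refl) (auto simp: le_less)
    also have "\<dots> = \<alpha> * iprod H (x N) g" using F(1) by (simp add: \<alpha>_def)
    finally have "cmod \<alpha> * cmod (iprod H (x N) g) \<le> hnorm H u * hnorm H g"
      using hilbert_cauchy_schwarz[OF uE g] by (simp add: norm_mult)
    then have "(cmod \<alpha> * cmod (iprod H (x N) g))\<^sup>2 \<le> (hnorm H u * hnorm H g)\<^sup>2"
      by (intro power_mono) auto
    then have \<alpha>: "(cmod \<alpha>)\<^sup>2 \<le> G * (hnorm H u)\<^sup>2"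
      using gN by (simp add: G_def power_mult_distrib field_simps)
    have "c * S \<le> 2 * (hnorm H u)\<^sup>2 + 2 * ((cmod \<alpha>)\<^sup>2 * X)"
      using hb(1) hnorm_diff_sq_le[OF uE aE] unfolding ab h[symmetric] by linarith
    also have "\<dots> \<le> 2 * (hnorm H u)\<^sup>2 + 2 * (G * (hnorm H u)\<^sup>2 * X)"
      using mult_right_mono[OF \<alpha> GX(2)] by simp
    finally have "S \<le> (2 + 2 * G * X) / c * (hnorm H u)\<^sup>2"
      using c by (simp add: field_simps)
    with \<alpha> have "(cmod \<alpha>)\<^sup>2 + S \<le> M * (hnorm H u)\<^sup>2"
      unfolding M_def distrib_right by linarith
    then have 1: "(1 / M) * (\<Sum>n\<in>F. (cmod (a n))\<^sup>2) \<le> (hnorm H u)\<^sup>2"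
      unfolding S using M by (simp add: field_simps)
    have "(hnorm H u)\<^sup>2 \<le> 2 * ((cmod \<alpha>)\<^sup>2 * X) + 2 * (C * S)"
      using hb(2) hnorm_add_sq_le[OF aE hE] unfolding ab u[symmetric] by linarith
    also have "\<dots> \<le> M' * ((cmod \<alpha>)\<^sup>2 + S)"
      using GX(2) S0 c by (simp add: M'_def algebra_simps)
    finally have 2: "(hnorm H u)\<^sup>2 \<le> M' * (\<Sum>n\<in>F. (cmod (a n))\<^sup>2)" unfolding S .
    show ?thesis using 1 2 unfolding u_def by blast
  qed
  then have "riesz_bounds H x N (1 / M) M'" using M by (simp add: riesz_bounds_def)
  then show ?thesis by blast
qed

lemma AOB_prepend:
  assumes aob: "AOB H (Suc N) x" and xN: "x N \<in> Elts H"
    and g: "g \<in> Elts H" "iprod H (x N) g \<noteq> 0" "\<And>n. n > N \<Longrightarrow> iprod H (x n) g = 0"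
  shows "AOB H N x"
proof -
  obtain c C where c: "\<And>M. M \<ge> Suc N \<Longrightarrow> riesz_bounds H x M (c M) (C M)"
    and lim: "c \<longlonglongrightarrow> 1" "C \<longlonglongrightarrow> 1" and x: "\<And>n. n \<ge> Suc N \<Longrightarrow> x n \<in> Elts H"
    using aob unfolding AOB_iff_riesz_bounds by blast
  have x': "x n \<in> Elts H" if "n \<ge> N" for n using that x xN by (cases "n = N") auto
  obtain c' C' where c': "riesz_bounds H x N c' C'"
    using riesz_bounds_prepend[OF c x' g] by auto
  have ev: "\<forall>\<^sub>F n in sequentially. n \<noteq> N"
    using eventually_gt_at_top[of N] by eventually_elim simp
  have "(c(N := c')) \<longlonglongrightarrow> 1" "(C(N := C')) \<longlonglongrightarrow> 1"
    by (rule Lim_transform_eventually[OF lim(1)], use ev in eventually_elim, simp)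
      (rule Lim_transform_eventually[OF lim(2)], use ev in eventually_elim, simp)
  moreover have "riesz_bounds H x M ((c(N := c')) M) ((C(N := C')) M)" if "M \<ge> N" for M
    using that c c' by (cases "M = N") auto
  ultimately show ?thesis unfolding AOB_iff_riesz_bounds using x' by blast
qed

end


section \<open>Dividing out a zero\<close>

text \<open>
  Here \<open>\<beta>\<close> and \<open>a\<close> stand for \<open>b(z)\<close> and \<open>b(l)\<close>, and \<open>w'\<close>, \<open>\<beta>'\<close>, \<open>l'\<close>, \<open>a'\<close> for the conjugates of
  \<open>w\<close>, \<open>b(w)\<close>, \<open>l\<close>, \<open>b(l)\<close>; the constant factor of the kernel is left out. Subtract from the
  kernel \<open>k\<^sub>w(z)\<close> the kernel of the subspace of functions vanishing at \<open>l\<close>, divided by the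
  Blaschke factor at \<open>l\<close> in \<open>z\<close> and by its conjugate in \<open>w\<close>. The difference has rank one.
\<close>

lemma blaschke_identity:
  fixes z w' l l' \<beta> \<beta>' a a' :: complex
  assumes "z \<noteq> w'" "z \<noteq> l" "w' \<noteq> l'" "w' \<noteq> l" "l \<noteq> l'" "z \<noteq> l'" "1 - a' * a \<noteq> 0"
  shows "(1 - \<beta>' * \<beta>) / (z - w') - ((1 - \<beta>' * \<beta>) / (z - w')
      - ((1 - \<beta>' * a) / (l - w')) * ((1 - a' * \<beta>) / (z - l')) / ((1 - a' * a) / (l - l')))
      * ((w' - l) / (w' - l')) * ((z - l') / (z - l))
    = (l' - l) / (1 - a' * a) * ((\<beta> - a) / (z - l)) * ((\<beta>' - a') / (w' - l'))"
proof -
  define d where "d = 1 - a' * a"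
  define P where "P = (w' - l') * (z - l)"
  have nz: "d \<noteq> 0" "P \<noteq> 0" "z - w' \<noteq> 0" "l - l' \<noteq> 0" "l - w' \<noteq> 0" "z - l' \<noteq> 0"
    using assms by (auto simp: d_def P_def)
  have 1: "((w' - l) / (w' - l')) * ((z - l') / (z - l)) = 1 - (z - w') * (l - l') / P"
    using nz(2) assms(2,3) by (simp add: P_def field_simps)
  have 2: "((1 - \<beta>' * a) / (l - w')) * ((1 - a' * \<beta>) / (z - l')) / (d / (l - l'))
      * (((w' - l) / (w' - l')) * ((z - l') / (z - l)))
      = - ((1 - \<beta>' * a) * (1 - a' * \<beta>) * (l - l') / (d * P))"
  proof -
    have "w' - l = - (l - w')" by simp
    then show ?thesis using nz assms(2,3) by (simp only: P_def) (simp add: divide_simps, algebra)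
  qed
  have "(1 - \<beta>' * \<beta>) / (z - w') - ((1 - \<beta>' * \<beta>) / (z - w')
      - ((1 - \<beta>' * a) / (l - w')) * ((1 - a' * \<beta>) / (z - l')) / (d / (l - l')))
      * ((w' - l) / (w' - l')) * ((z - l') / (z - l))
    = (1 - \<beta>' * \<beta>) / (z - w') * (1 - ((w' - l) / (w' - l')) * ((z - l') / (z - l)))
      + ((1 - \<beta>' * a) / (l - w')) * ((1 - a' * \<beta>) / (z - l')) / (d / (l - l'))
      * (((w' - l) / (w' - l')) * ((z - l') / (z - l)))"
    by (simp only: left_diff_distrib right_diff_distrib mult.assoc) simp
  also have "\<dots> = (1 - \<beta>' * \<beta>) * (l - l') / P
      - (1 - \<beta>' * a) * (1 - a' * \<beta>) * (l - l') / (d * P)"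
    unfolding 2 unfolding 1 using nz(3) by simp
  also have "\<dots> = (l - l') * ((1 - \<beta>' * \<beta>) * d - (1 - \<beta>' * a) * (1 - a' * \<beta>)) / (d * P)"
    using nz(1,2) by (simp add: field_simps)
  also have "(1 - \<beta>' * \<beta>) * d - (1 - \<beta>' * a) * (1 - a' * \<beta>) = - ((\<beta> - a) * (\<beta>' - a'))"
    by (simp add: d_def algebra_simps)
  also have "(l - l') * - ((\<beta> - a) * (\<beta>' - a')) / (d * P)
      = (l' - l) / d * ((\<beta> - a) / (z - l)) * ((\<beta>' - a') / (w' - l'))"
    using nz(1,2) assms(2,3) by (simp add: P_def field_simps)
  finally show ?thesis unfolding d_def .
qed

context de_branges_rovnyak_space
begin

text \<open>
  Division by the Blaschke factor at \<open>\<xi>\<close> maps the functions vanishing at \<open>\<xi>\<close> back into the space.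
  The quotient is found as the solution of a moment problem for its values at the points other than
  \<open>\<xi>\<close>; the required bound is the positivity of the rank one kernel above.
\<close>

lemma blaschke_quotient:
  assumes lam: "\<xi> \<in> upper_half_plane" and nd: "dbr_kernel b \<xi> \<xi> \<noteq> 0"
    and f: "f \<in> Elts H" and f0: "f \<xi> = 0"
  shows "\<exists>g\<in>Elts H. \<forall>z\<in>upper_half_plane - {\<xi>}. g z = f z * (z - cnj \<xi>) / (z - \<xi>)"
proof -
  define K where "K = dbr_kernel b"
  define B where "B = (\<lambda>z. (z - \<xi>) / (z - cnj \<xi>))"
  define I where "I = upper_half_plane - {\<xi>}"
  \<comment> \<open>\<open>P w\<close> is the projection of \<open>K w\<close> onto the functions vanishing at \<open>\<xi>\<close>, and \<open>y w\<close> represents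
    the value of the quotient at \<open>w\<close>.\<close>
  define P where "P = (\<lambda>w z. K w z - K w \<xi> / K \<xi> \<xi> * K \<xi> z)"
  define y where "y = (\<lambda>w z. 1 / cnj (B w) * P w z)"
  have KE: "K w \<in> Elts H" if "w \<in> upper_half_plane" for w
    unfolding K_def using that by (rule kernel_closed)
  have PE: "P w \<in> Elts H" if "w \<in> upper_half_plane" for w
    unfolding P_def using KE that lam by (intro diff_closed scale_closed) auto
  have yE: "y w \<in> Elts H" if "w \<in> upper_half_plane" for w
    unfolding y_def using PE that by (intro scale_closed) auto
  have I: "w \<in> upper_half_plane" "w \<noteq> \<xi>" "w \<noteq> cnj \<xi>" "cnj w \<noteq> \<xi>" "cnj w \<noteq> cnj \<xi>" if "w \<in> I" for w
    using that lam by (auto simp: I_def upper_half_plane_def complex_eq_iff)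
  have Py: "iprod H (P w) h = cnj (h w) - K w \<xi> / K \<xi> \<xi> * cnj (h \<xi>)"
    if "w \<in> upper_half_plane" "h \<in> Elts H" for w h
    unfolding P_def
    by (subst iprod_diff_left) (auto simp: that KE scale_closed lam iprod_scale_left
        iprod_kernel_left[folded K_def] simp del: times_divide_eq_left)
  have yf: "iprod H (y w) f = cnj (f w / B w)" if "w \<in> upper_half_plane" for w
    unfolding y_def using that f f0 by (subst iprod_scale_left[OF PE]) (auto simp: Py)
  have K0: "K \<xi> \<xi> \<noteq> 0" using nd by (simp add: K_def)
  have PP: "iprod H (P w) (P v) = K w v - K w \<xi> * K \<xi> v / K \<xi> \<xi>"
    if w: "w \<in> upper_half_plane" and v: "v \<in> upper_half_plane" for w v
  proof -
    have h: "cnj (K p q) = K q p" if "p \<in> upper_half_plane" "q \<in> upper_half_plane" for p q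
      using kernel_hermitian[OF that] by (simp add: K_def)
    have "P v \<xi> = 0" using K0 by (simp add: P_def)
    then have "iprod H (P w) (P v) = cnj (P v w)" using Py[OF w PE[OF v]] by simp
    also have "\<dots> = K w v - K \<xi> v / K \<xi> \<xi> * K w \<xi>"
      using h w v lam by (simp add: P_def)
    finally show ?thesis by simp
  qed
  define c where "c = Im \<xi> / (pi * (1 - (cmod (b \<xi>))\<^sup>2))"
  have "0 \<le> (hnorm H (dbr_kernel b \<xi>))\<^sup>2" "dbr_kernel b \<xi> \<xi> = of_real ((hnorm H (dbr_kernel b \<xi>))\<^sup>2)"
    using iprod_self[OF kernel_closed[OF lam]] iprod_kernels[OF lam lam] by simp_all
  then have "0 < (1 - (cmod (b \<xi>))\<^sup>2) / (4 * pi * Im \<xi>)"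
    using nd hnorm_kernel[OF lam] by (metis less_le of_real_0)
  moreover have Iml: "0 < Im \<xi>" using lam by (simp add: upper_half_plane_def)
  ultimately have d: "0 < 1 - (cmod (b \<xi>))\<^sup>2" by (auto simp: zero_less_divide_iff mult_less_0_iff)
  have c: "0 \<le> c" using d Iml by (simp add: c_def)
  define t where "t = (\<lambda>w. (b w - b \<xi>) / (w - \<xi>))"
  have key: "K w v - iprod H (y w) (y v) = of_real c * (cnj (t w) * t v)" if w: "w \<in> I" and v: "v \<in> I" for w v
  proof -
    define k where "k = \<i> / (2 * of_real pi)"
    have vw: "v - cnj w \<noteq> 0" "\<xi> \<noteq> cnj \<xi>" using w v lam
      by (auto simp: I_def upper_half_plane_def complex_eq_iff)
    have dd: "1 - cnj (b \<xi>) * b \<xi> = of_real (1 - (cmod (b \<xi>))\<^sup>2)"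
      by (simp add: complex_norm_square mult.commute del: of_real_power)
    have d0: "1 - cnj (b \<xi>) * b \<xi> \<noteq> 0" using d unfolding dd by (metis less_irrefl of_real_eq_0_iff)
    have k0: "k \<noteq> 0" by (simp add: k_def)
    have Kk: "K p q = k * ((1 - cnj (b p) * b q) / (q - cnj p))" if "q \<in> upper_half_plane" for p q
      using that by (simp add: K_def dbr_kernel_def k_def)
    have "iprod H (y w) (y v) = 1 / cnj (B w) * (1 / B v) * iprod H (P w) (P v)"
      unfolding y_def using I[OF w] I[OF v] PE
      by (simp add: iprod_scale_left iprod_scale_right scale_closed del: times_divide_eq_left)
    also have "\<dots> = ((cnj w - \<xi>) / (cnj w - cnj \<xi>)) * ((v - cnj \<xi>) / (v - \<xi>)) * iprod H (P w) (P v)"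
      by (simp add: B_def)
    also have "iprod H (P w) (P v) = k * ((1 - cnj (b w) * b v) / (v - cnj w)
      - ((1 - cnj (b w) * b \<xi>) / (\<xi> - cnj w)) * ((1 - cnj (b \<xi>) * b v) / (v - cnj \<xi>))
        / ((1 - cnj (b \<xi>) * b \<xi>) / (\<xi> - cnj \<xi>)))"
      unfolding PP[OF I(1)[OF w] I(1)[OF v]] Kk[OF I(1)[OF v]] Kk[OF lam] right_diff_distrib
      using k0 by (simp add: mult_ac)
    finally have "K w v - iprod H (y w) (y v) = k * (
      (1 - cnj (b w) * b v) / (v - cnj w) - ((1 - cnj (b w) * b v) / (v - cnj w)
      - ((1 - cnj (b w) * b \<xi>) / (\<xi> - cnj w)) * ((1 - cnj (b \<xi>) * b v) / (v - cnj \<xi>))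
        / ((1 - cnj (b \<xi>) * b \<xi>) / (\<xi> - cnj \<xi>)))
      * ((cnj w - \<xi>) / (cnj w - cnj \<xi>)) * ((v - cnj \<xi>) / (v - \<xi>)))"
      unfolding Kk[OF I(1)[OF v]] by (simp only: right_diff_distrib mult_ac)
    also have "\<dots> = k * ((cnj \<xi> - \<xi>) / (1 - cnj (b \<xi>) * b \<xi>) * ((b v - b \<xi>) / (v - \<xi>))
      * ((cnj (b w) - cnj (b \<xi>)) / (cnj w - cnj \<xi>)))"
      using I[OF w] I[OF v] vw d0 by (subst blaschke_identity) auto
    also have "\<dots> = k * (cnj \<xi> - \<xi>) / (1 - cnj (b \<xi>) * b \<xi>) * (cnj (t w) * t v)"
      by (simp add: t_def mult_ac)
    also have "k * (cnj \<xi> - \<xi>) / (1 - cnj (b \<xi>) * b \<xi>) = of_real c"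
    proof -
      have "k * (cnj \<xi> - \<xi>) = of_real (Im \<xi> / pi)" by (simp add: k_def complex_eq_iff)
      then show ?thesis unfolding dd c_def by simp
    qed
    finally show ?thesis .
  qed
  have contr: "hnorm H (\<lambda>z. \<Sum>w\<in>F. a w * y w z) \<le> hnorm H (\<lambda>z. \<Sum>w\<in>F. a w * K w z)"
    if F: "finite F" "F \<subseteq> I" for F a
  proof (rule power2_le_imp_le)
    have "(hnorm H (\<lambda>z. \<Sum>w\<in>F. a w * K w z))\<^sup>2 - (hnorm H (\<lambda>z. \<Sum>w\<in>F. a w * y w z))\<^sup>2
        = Re (\<Sum>w\<in>F. \<Sum>v\<in>F. a w * cnj (a v) * iprod H (K w) (K v))
          - Re (\<Sum>w\<in>F. \<Sum>v\<in>F. a w * cnj (a v) * iprod H (y w) (y v))"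
      using F I KE yE by (subst (1 2) hnorm_sum_sq) auto
    also have "\<dots> = Re (\<Sum>w\<in>F. \<Sum>v\<in>F. a w * cnj (a v) * (K w v - iprod H (y w) (y v)))"
      unfolding minus_complex.sel(1)[symmetric] sum_subtractf[symmetric] right_diff_distrib[symmetric]
      using F I by (intro arg_cong[where f = Re] sum.cong refl)
        (auto simp: iprod_kernels[folded K_def] subset_iff)
    also have "(\<Sum>w\<in>F. \<Sum>v\<in>F. a w * cnj (a v) * (K w v - iprod H (y w) (y v)))
        = (\<Sum>w\<in>F. \<Sum>v\<in>F. of_real c * ((a w * cnj (t w)) * cnj (a v * cnj (t v))))"
      using F by (intro sum.cong refl) (simp add: key subset_iff mult_ac)
    also have "\<dots> = of_real c * ((\<Sum>w\<in>F. a w * cnj (t w)) * cnj (\<Sum>w\<in>F. a w * cnj (t w)))"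
      by (simp only: cnj_sum sum_product) (simp only: sum_distrib_left)
    also have "\<dots> = of_real (c * (cmod (\<Sum>w\<in>F. a w * cnj (t w)))\<^sup>2)"
      by (simp only: complex_norm_square of_real_mult)
    finally have "(hnorm H (\<lambda>z. \<Sum>w\<in>F. a w * K w z))\<^sup>2 - (hnorm H (\<lambda>z. \<Sum>w\<in>F. a w * y w z))\<^sup>2
        = c * (cmod (\<Sum>w\<in>F. a w * cnj (t w)))\<^sup>2" by (simp only: Re_complex_of_real)
    moreover have "0 \<le> c * (cmod (\<Sum>w\<in>F. a w * cnj (t w)))\<^sup>2" using c by simp
    ultimately show "(hnorm H (\<lambda>z. \<Sum>w\<in>F. a w * y w z))\<^sup>2 \<le> (hnorm H (\<lambda>z. \<Sum>w\<in>F. a w * K w z))\<^sup>2"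
      by linarith
    show "0 \<le> hnorm H (\<lambda>z. \<Sum>w\<in>F. a w * K w z)"
      using F I KE by (intro hnorm_nonneg sum_closed) auto
  qed
  have "\<exists>G \<in> norm_closure H (lin_span (K ` I)). \<forall>w\<in>I. iprod H (K w) G = cnj (f w / B w)"
  proof (rule moment_problem[where C = "hnorm H f"])
    fix F a assume F: "finite F" "F \<subseteq> I"
    then have yF: "\<And>w. w \<in> F \<Longrightarrow> y w \<in> Elts H" using yE I by blast
    have "(\<Sum>w\<in>F. a w * cnj (f w / B w)) = iprod H (\<lambda>z. \<Sum>w\<in>F. a w * y w z) f"
      using F I by (subst iprod_sum_left[OF yF f]) (auto intro!: sum.cong simp: yf subset_iff)
    then have "cmod (\<Sum>w\<in>F. a w * cnj (f w / B w)) = cmod (iprod H (\<lambda>z. \<Sum>w\<in>F. a w * y w z) f)"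
      by (rule arg_cong)
    also have "\<dots> \<le> hnorm H (\<lambda>z. \<Sum>w\<in>F. a w * y w z) * hnorm H f"
      by (rule hilbert_cauchy_schwarz[OF sum_closed f]) (rule yF)
    also have "\<dots> \<le> hnorm H (\<lambda>z. \<Sum>w\<in>F. a w * K w z) * hnorm H f"
      by (intro mult_right_mono contr F hnorm_nonneg f)
    finally show "cmod (\<Sum>w\<in>F. a w * cnj (f w / B w))
        \<le> hnorm H f * hnorm H (\<lambda>z. \<Sum>w\<in>F. a w * K w z)" by (simp add: mult.commute)
  qed (use KE I in auto)
  then obtain G where G: "G \<in> Elts H" "\<And>w. w \<in> I \<Longrightarrow> iprod H (K w) G = cnj (f w / B w)"
    unfolding norm_closure_def by blast
  have "G z = f z * (z - cnj \<xi>) / (z - \<xi>)" if "z \<in> I" for z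
  proof -
    have "cnj (G z) = cnj (f z / B z)"
      using G(2)[OF that] iprod_kernel_left[OF G(1) I(1)[OF that]] by (simp add: K_def)
    then have "G z = f z / B z" by (simp only: complex_cnj_cancel_iff)
    then show ?thesis by (simp add: B_def)
  qed
  then show ?thesis using G(1) unfolding I_def by blast
qed

text \<open>
  A zero of a member of the space can be moved to any other point: multiply by
  \<open>(z - \<mu>) / (z - \<xi>)\<close>, which is an affine function of the inverse Blaschke factor at \<open>\<xi>\<close>.
\<close>

lemma exchange_zero:
  assumes f: "f \<in> Elts H" and xi: "\<xi> \<in> upper_half_plane" and mu: "\<mu> \<in> upper_half_plane"
    and f0: "f \<xi> = 0" and f1: "f \<mu> \<noteq> 0"
  shows "\<exists>g\<in>Elts H. g \<mu> = 0 \<and> g \<noteq> (\<lambda>z. 0) \<and> (\<forall>z\<in>upper_half_plane - {\<xi>}. f z = 0 \<longrightarrow> g z = 0)"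
proof -
  have nd: "dbr_kernel b \<xi> \<xi> \<noteq> 0"
  proof
    \<comment> \<open>Otherwise \<open>b\<close> is a unimodular constant and the whole space is zero.\<close>
    assume "dbr_kernel b \<xi> \<xi> = 0"
    then have K: "dbr_kernel b \<xi> = (\<lambda>z. 0)"
      using iprod_definite[OF kernel_closed[OF xi]] iprod_kernels[OF xi xi] by simp
    have one: "cnj (b \<xi>) * b z = 1" if "z \<in> upper_half_plane" for z
    proof -
      have "z - cnj \<xi> \<noteq> 0" using that xi by (auto simp: upper_half_plane_def complex_eq_iff)
      then show ?thesis using fun_cong[OF K, of z] that by (simp add: dbr_kernel_def)
    qed
    then have "cnj (b \<xi>) * b \<mu> = cnj (b \<xi>) * b \<xi>" using xi mu by simp
    moreover have "cnj (b \<xi>) \<noteq> 0" using one[OF xi] by force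
    ultimately have "b \<mu> = b \<xi>" using mult_left_cancel by blast
    then have "dbr_kernel b \<mu> \<mu> = 0" using one[OF xi] by (simp add: dbr_kernel_def)
    then have "dbr_kernel b \<mu> = (\<lambda>z. 0)"
      using iprod_definite[OF kernel_closed[OF mu]] iprod_kernels[OF mu mu] by simp
    then have "cnj (f \<mu>) = 0"
      using iprod_kernel_left[OF f mu] iprod_zero_left[OF f] by simp
    then show False using f1 by simp
  qed
  obtain h where h: "h \<in> Elts H"
    and hz: "\<And>z. z \<in> upper_half_plane - {\<xi>} \<Longrightarrow> h z = f z * (z - cnj \<xi>) / (z - \<xi>)"
    using blaschke_quotient[OF xi nd f f0] by blast
  define A where "A = (\<mu> - cnj \<xi>) / (\<xi> - cnj \<xi>)"
  define B where "B = (\<xi> - \<mu>) / (\<xi> - cnj \<xi>)"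
  define g where "g = (\<lambda>z. A * f z + B * h z)"
  have ne: "\<xi> - cnj \<xi> \<noteq> 0" using xi by (auto simp: upper_half_plane_def complex_eq_iff)
  have gE: "g \<in> Elts H" unfolding g_def by (intro add_closed scale_closed f h)
  have gz: "g z = f z * (z - \<mu>) / (z - \<xi>)" if z: "z \<in> upper_half_plane - {\<xi>}" for z
  proof -
    have nz: "z - \<xi> \<noteq> 0" using z by auto
    have "A * (z - \<xi>) + B * (z - cnj \<xi>)
        = ((\<mu> - cnj \<xi>) * (z - \<xi>) + (\<xi> - \<mu>) * (z - cnj \<xi>)) / (\<xi> - cnj \<xi>)"
      by (simp add: A_def B_def add_divide_distrib)
    also have "(\<mu> - cnj \<xi>) * (z - \<xi>) + (\<xi> - \<mu>) * (z - cnj \<xi>) = (z - \<mu>) * (\<xi> - cnj \<xi>)"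
      by (simp add: algebra_simps)
    finally have AB: "A * (z - \<xi>) + B * (z - cnj \<xi>) = z - \<mu>" using ne by simp
    have "g z = f z * (A * (z - \<xi>) + B * (z - cnj \<xi>)) / (z - \<xi>)"
      unfolding g_def hz[OF z] using nz by (simp add: field_simps)
    then show ?thesis unfolding AB .
  qed
  have "\<mu> \<noteq> \<xi>" using f0 f1 by auto
  then have "g \<mu> = 0" using gz[of \<mu>] mu by simp
  moreover have "g \<noteq> (\<lambda>z. 0)"
  proof
    assume g0: "g = (\<lambda>z. 0)"
    have op: "open upper_half_plane"
      unfolding upper_half_plane_def by (rule open_halfspace_Im_gt)
    have "isCont f \<mu>"
      using analytic[OF f] op mu by (metis continuous_on_eq_continuous_at holomorphic_on_imp_continuous_on)
    then have "(f \<longlongrightarrow> f \<mu>) (at \<mu>)" by (simp add: isCont_def)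
    moreover have "(f \<longlongrightarrow> 0) (at \<mu>)"
    proof (rule tendsto_eventually)
      have "open (upper_half_plane - {\<xi>})" "\<mu> \<in> upper_half_plane - {\<xi>}"
        using op mu \<open>\<mu> \<noteq> \<xi>\<close> by auto
      from eventually_at_in_open[OF this] show "\<forall>\<^sub>F z in at \<mu>. f z = 0"
      proof eventually_elim
        case (elim z)
        then have "f z * (z - \<mu>) / (z - \<xi>) = 0" using gz[of z] g0 by auto
        then show ?case using elim by auto
      qed
    qed
    ultimately show False using f1 tendsto_unique[OF at_neq_bot] by blast
  qed
  moreover have "\<forall>z\<in>upper_half_plane - {\<xi>}. f z = 0 \<longrightarrow> g z = 0" using gz by auto
  ultimately show ?thesis using gE by blast
qed

end


section \<open>Transfer of Riesz bounds\<close>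

context dbr_factorisation
begin

lemma normalized_combination:
  "(\<Sum>n\<in>F. a n * normalized_kernel b' H' (l n) z)
    = (\<Sum>n\<in>F. (a n / of_real (hnorm H' (dbr_kernel b' (l n)))) * dbr_kernel b' (l n) z)"
  by (simp add: normalized_kernel_def)

lemma kernel_ratio_bounds:
  assumes "w \<in> upper_half_plane" "0 < hnorm H2 (dbr_kernel b2 w)"
  shows "1 \<le> kernel_ratio b1 H1 b2 H2 w" "0 < hnorm H1 (dbr_kernel b1 w)"
proof -
  show 1: "1 \<le> kernel_ratio b1 H1 b2 H2 w"
    unfolding kernel_ratio_def using kernel_norm_le[OF assms(1)] assms(2) by simp
  have "0 \<le> hnorm H1 (dbr_kernel b1 w)" by (intro S1.hnorm_nonneg S1.kernel_closed assms)
  moreover have "hnorm H1 (dbr_kernel b1 w) \<noteq> 0"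
    using 1 by (auto simp: kernel_ratio_def)
  ultimately show "0 < hnorm H1 (dbr_kernel b1 w)" by simp
qed

text \<open>
  Writing a combination of normalised kernels of one space in terms of those of the other rescales
  the coefficients by the square root of the kernel ratio or by its inverse. The kernel ratio lies
  between \<open>1\<close> and \<open>1 + \<delta>\<close>, and the defect form is at most \<open>\<delta>\<close> times the sum of the \<open>|a n|\<^sup>2\<close>.
\<close>

lemma riesz_bounds_up:
  assumes l: "\<And>n. n \<ge> N \<Longrightarrow> l n \<in> upper_half_plane"
    and rb: "riesz_bounds H2 (\<lambda>n. normalized_kernel b2 H2 (l n)) N c C"
    and \<delta>: "\<And>F. finite F \<Longrightarrow> F \<subseteq> {N..} \<Longrightarrow> (\<Sum>n\<in>F. \<bar>kernel_ratio b1 H1 b2 H2 (l n) - 1\<bar>) \<le> \<delta>"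
  shows "riesz_bounds H1 (\<lambda>n. normalized_kernel b1 H1 (l n)) N (c / (1 + \<delta>)) (C + \<delta>)"
proof -
  define n1 where "n1 = (\<lambda>n. hnorm H1 (dbr_kernel b1 (l n)))"
  define n2 where "n2 = (\<lambda>n. hnorm H2 (dbr_kernel b2 (l n)))"
  have n1_eq: "hnorm H1 (dbr_kernel b1 (l n)) = n1 n" for n by (simp add: n1_def)
  have n2_eq: "hnorm H2 (dbr_kernel b2 (l n)) = n2 n" for n by (simp add: n2_def)
  define R where "R = (\<lambda>n. kernel_ratio b1 H1 b2 H2 (l n))"
  have n2: "0 < n2 n" if "n \<ge> N" for n
  proof -
    have "n2 n \<noteq> 0"
    proof
      assume "n2 n = 0"
      then have "normalized_kernel b2 H2 (l n) = (\<lambda>z. 0)"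
        by (simp add: n2_def normalized_kernel_def)
      then show False using S2.riesz_bounds_nonzero[OF rb that] by simp
    qed
    moreover have "0 \<le> n2 n"
      unfolding n2_def using l[OF that] by (intro S2.hnorm_nonneg S2.kernel_closed)
    ultimately show ?thesis by simp
  qed
  have R: "1 \<le> R n" "0 < n1 n" if "n \<ge> N" for n
    using kernel_ratio_bounds[OF l[OF that]] n2[OF that] by (simp_all add: R_def n1_def n2_def)
  have R_eq: "R n = (n1 n)\<^sup>2 / (n2 n)\<^sup>2" for n by (simp add: R_def kernel_ratio_def n1_def n2_def)
  have \<delta>0: "0 \<le> \<delta>" using \<delta>[of "{}"] by simp
  have R\<delta>: "R n \<le> 1 + \<delta>" if "n \<ge> N" for n
    using \<delta>[of "{n}"] that by (simp add: R_def)
  have cC: "0 < c" "0 < C" using rb by (auto simp: riesz_bounds_def)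
  have "c / (1 + \<delta>) * (\<Sum>n\<in>F. (cmod (a n))\<^sup>2)
      \<le> (hnorm H1 (\<lambda>z. \<Sum>n\<in>F. a n * normalized_kernel b1 H1 (l n) z))\<^sup>2 \<and>
      (hnorm H1 (\<lambda>z. \<Sum>n\<in>F. a n * normalized_kernel b1 H1 (l n) z))\<^sup>2
      \<le> (C + \<delta>) * (\<Sum>n\<in>F. (cmod (a n))\<^sup>2)" if F: "finite F" "F \<subseteq> {N..}" for F a
  proof -
    have FN: "n \<ge> N" if "n \<in> F" for n using F(2) that by auto
    have lF: "l n \<in> upper_half_plane" if "n \<in> F" for n using l FN that by blast
    have n2_ne: "n2 n \<noteq> 0" if "n \<in> F" for n using n2[OF FN[OF that]] by simp
    define S where "S = (\<Sum>n\<in>F. (cmod (a n))\<^sup>2)"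
    define S' where "S' = (\<Sum>n\<in>F. (cmod (a n * of_real (n2 n / n1 n)))\<^sup>2)"
    define E where "E = Re (\<Sum>i\<in>F. \<Sum>j\<in>F. (a i / of_real (n1 i)) * cnj (a j / of_real (n1 j)) * defect (l i) (l j))"
    define Y where "Y = (hnorm H2 (\<lambda>z. \<Sum>n\<in>F. (a n * of_real (n2 n / n1 n)) * normalized_kernel b2 H2 (l n) z))\<^sup>2"
    have "(hnorm H1 (\<lambda>z. \<Sum>n\<in>F. a n * normalized_kernel b1 H1 (l n) z))\<^sup>2
        = (hnorm H2 (\<lambda>z. \<Sum>n\<in>F. (a n / of_real (n1 n)) * dbr_kernel b2 (l n) z))\<^sup>2 + E"
      unfolding normalized_combination n1_eq E_def by (rule combination_norms[OF lF])
    also have "(\<lambda>z. \<Sum>n\<in>F. (a n / of_real (n1 n)) * dbr_kernel b2 (l n) z)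
        = (\<lambda>z. \<Sum>n\<in>F. (a n * of_real (n2 n / n1 n)) * normalized_kernel b2 H2 (l n) z)"
      unfolding normalized_combination n2_eq
      using n2_ne by (intro ext sum.cong refl) auto
    finally have split: "(hnorm H1 (\<lambda>z. \<Sum>n\<in>F. a n * normalized_kernel b1 H1 (l n) z))\<^sup>2 = Y + E"
      by (simp only: Y_def)
    have Y: "c * S' \<le> Y" "Y \<le> C * S'"
      unfolding Y_def S'_def by (rule riesz_boundsD[OF rb F])+
    have E0: "0 \<le> E" unfolding E_def by (rule defect_positive[OF F(1) lF])
    have S0: "0 \<le> S" by (simp add: S_def sum_nonneg)
    have S'_eq: "S' = (\<Sum>n\<in>F. (cmod (a n))\<^sup>2 * (1 / R n))"
      unfolding S'_def R_eq by (simp add: norm_mult power_mult_distrib norm_divide power_divide)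
    have "E \<le> S * (\<Sum>n\<in>F. ((n1 n)\<^sup>2 - (n2 n)\<^sup>2) / (n1 n)\<^sup>2)"
      unfolding E_def S_def n1_def n2_def using R(2) FN
      by (intro defect_trace_bound F(1) lF) (auto simp: n1_def)
    also have "(\<Sum>n\<in>F. ((n1 n)\<^sup>2 - (n2 n)\<^sup>2) / (n1 n)\<^sup>2) \<le> (\<Sum>n\<in>F. \<bar>R n - 1\<bar>)"
    proof (intro sum_mono)
      fix n assume "n \<in> F"
      then have n: "n \<ge> N" by (rule FN)
      have le: "(n2 n)\<^sup>2 \<le> (n1 n)\<^sup>2"
        unfolding n1_def n2_def by (rule kernel_norm_le[OF l[OF n]])
      have "((n1 n)\<^sup>2 - (n2 n)\<^sup>2) / (n1 n)\<^sup>2 \<le> ((n1 n)\<^sup>2 - (n2 n)\<^sup>2) / (n2 n)\<^sup>2"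
        using le n2[OF n] R(2)[OF n] by (intro divide_left_mono) auto
      also have "\<dots> = R n - 1" using n2[OF n] by (simp add: R_eq diff_divide_distrib)
      finally show "((n1 n)\<^sup>2 - (n2 n)\<^sup>2) / (n1 n)\<^sup>2 \<le> \<bar>R n - 1\<bar>" by simp
    qed
    also have "\<dots> \<le> \<delta>" using \<delta>[OF F] by (simp add: R_def)
    finally have E1: "E \<le> S * \<delta>" using S0 by (simp add: mult_left_mono)
    have inv_R: "0 \<le> 1 / R n" "1 / R n \<le> 1" "1 / (1 + \<delta>) \<le> 1 / R n" if "n \<in> F" for n
      using R(1)[OF FN[OF that]] R\<delta>[OF FN[OF that]] by (auto intro: frac_le)
    have "S' \<le> S" unfolding S'_eq S_def
      by (intro sum_mono mult_right_le_one_le inv_R) auto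
    then have "C * S' \<le> C * S" using cC by simp
    then have up: "Y + E \<le> (C + \<delta>) * S" using Y(2) E1 by (simp add: algebra_simps)
    have "S / (1 + \<delta>) = (\<Sum>n\<in>F. (cmod (a n))\<^sup>2 * (1 / (1 + \<delta>)))"
      by (simp add: S_def sum_divide_distrib)
    also have "\<dots> \<le> S'"
      unfolding S'_eq by (intro sum_mono mult_left_mono inv_R) auto
    finally have "c * (S / (1 + \<delta>)) \<le> c * S'" using cC(1) by (intro mult_left_mono) auto
    then have "c / (1 + \<delta>) * S \<le> Y + E" using Y(1) E0 by simp
    with up show ?thesis unfolding split S_def by blast
  qed
  then show ?thesis unfolding riesz_bounds_def using cC \<delta>0 by (simp add: add_pos_nonneg)
qed

lemma riesz_bounds_down:
  assumes l: "\<And>n. n \<ge> N \<Longrightarrow> l n \<in> upper_half_plane"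
    and rb: "riesz_bounds H1 (\<lambda>n. normalized_kernel b1 H1 (l n)) N c C"
    and n2: "\<And>n. n \<ge> N \<Longrightarrow> 0 < hnorm H2 (dbr_kernel b2 (l n))"
    and \<delta>: "\<And>F. finite F \<Longrightarrow> F \<subseteq> {N..} \<Longrightarrow> (\<Sum>n\<in>F. \<bar>kernel_ratio b1 H1 b2 H2 (l n) - 1\<bar>) \<le> \<delta>"
    and \<delta>c: "\<delta> < c"
  shows "riesz_bounds H2 (\<lambda>n. normalized_kernel b2 H2 (l n)) N (c - \<delta>) (C * (1 + \<delta>))"
proof -
  define n1 where "n1 = (\<lambda>n. hnorm H1 (dbr_kernel b1 (l n)))"
  define n2 where "n2 = (\<lambda>n. hnorm H2 (dbr_kernel b2 (l n)))"
  have n1_eq: "hnorm H1 (dbr_kernel b1 (l n)) = n1 n" for n by (simp add: n1_def)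
  have n2_eq: "hnorm H2 (dbr_kernel b2 (l n)) = n2 n" for n by (simp add: n2_def)
  define R where "R = (\<lambda>n. kernel_ratio b1 H1 b2 H2 (l n))"
  have n2: "0 < n2 n" if "n \<ge> N" for n
    unfolding n2_def by (rule assms(3)[OF that])
  have R: "1 \<le> R n" "0 < n1 n" if "n \<ge> N" for n
    using kernel_ratio_bounds[OF l[OF that]] n2[OF that] by (simp_all add: R_def n1_def n2_def)
  have R_eq: "R n = (n1 n)\<^sup>2 / (n2 n)\<^sup>2" for n by (simp add: R_def kernel_ratio_def n1_def n2_def)
  have \<delta>0: "0 \<le> \<delta>" using \<delta>[of "{}"] by simp
  have R\<delta>: "R n \<le> 1 + \<delta>" if "n \<ge> N" for n
    using \<delta>[of "{n}"] that by (simp add: R_def)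
  have cC: "0 < c" "0 < C" using rb by (auto simp: riesz_bounds_def)
  have "(c - \<delta>) * (\<Sum>n\<in>F. (cmod (a n))\<^sup>2)
      \<le> (hnorm H2 (\<lambda>z. \<Sum>n\<in>F. a n * normalized_kernel b2 H2 (l n) z))\<^sup>2 \<and>
      (hnorm H2 (\<lambda>z. \<Sum>n\<in>F. a n * normalized_kernel b2 H2 (l n) z))\<^sup>2
      \<le> C * (1 + \<delta>) * (\<Sum>n\<in>F. (cmod (a n))\<^sup>2)" if F: "finite F" "F \<subseteq> {N..}" for F a
  proof -
    have FN: "n \<ge> N" if "n \<in> F" for n using F(2) that by auto
    have lF: "l n \<in> upper_half_plane" if "n \<in> F" for n using l FN that by blast
    have n1_ne: "n1 n \<noteq> 0" if "n \<in> F" for n using R(2)[OF FN[OF that]] by simp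
    define S where "S = (\<Sum>n\<in>F. (cmod (a n))\<^sup>2)"
    define S' where "S' = (\<Sum>n\<in>F. (cmod (a n * of_real (n1 n / n2 n)))\<^sup>2)"
    define E where "E = Re (\<Sum>i\<in>F. \<Sum>j\<in>F. (a i / of_real (n2 i)) * cnj (a j / of_real (n2 j)) * defect (l i) (l j))"
    define Y where "Y = (hnorm H1 (\<lambda>z. \<Sum>n\<in>F. (a n * of_real (n1 n / n2 n)) * normalized_kernel b1 H1 (l n) z))\<^sup>2"
    have "(hnorm H1 (\<lambda>z. \<Sum>n\<in>F. (a n / of_real (n2 n)) * dbr_kernel b1 (l n) z))\<^sup>2
        = (hnorm H2 (\<lambda>z. \<Sum>n\<in>F. a n * normalized_kernel b2 H2 (l n) z))\<^sup>2 + E"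
      unfolding normalized_combination n2_eq E_def by (rule combination_norms[OF lF])
    also have "(\<lambda>z. \<Sum>n\<in>F. (a n / of_real (n2 n)) * dbr_kernel b1 (l n) z)
        = (\<lambda>z. \<Sum>n\<in>F. (a n * of_real (n1 n / n2 n)) * normalized_kernel b1 H1 (l n) z)"
      unfolding normalized_combination n1_eq
      using n1_ne by (intro ext sum.cong refl) auto
    finally have split: "Y = (hnorm H2 (\<lambda>z. \<Sum>n\<in>F. a n * normalized_kernel b2 H2 (l n) z))\<^sup>2 + E"
      by (simp only: Y_def)
    have Y: "c * S' \<le> Y" "Y \<le> C * S'"
      unfolding Y_def S'_def by (rule riesz_boundsD[OF rb F])+
    have E0: "0 \<le> E" unfolding E_def by (rule defect_positive[OF F(1) lF])
    have S0: "0 \<le> S" by (simp add: S_def sum_nonneg)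
    have S'_eq: "S' = (\<Sum>n\<in>F. (cmod (a n))\<^sup>2 * R n)"
      unfolding S'_def R_eq by (simp add: norm_mult power_mult_distrib norm_divide power_divide)
    have "E \<le> S * (\<Sum>n\<in>F. ((n1 n)\<^sup>2 - (n2 n)\<^sup>2) / (n2 n)\<^sup>2)"
      unfolding E_def S_def n1_def n2_def using n2 FN
      by (intro defect_trace_bound F(1) lF) (auto simp: n2_def)
    also have "(\<Sum>n\<in>F. ((n1 n)\<^sup>2 - (n2 n)\<^sup>2) / (n2 n)\<^sup>2) \<le> (\<Sum>n\<in>F. \<bar>R n - 1\<bar>)"
    proof (intro sum_mono)
      fix n assume "n \<in> F"
      from n2[OF FN[OF this]] have "((n1 n)\<^sup>2 - (n2 n)\<^sup>2) / (n2 n)\<^sup>2 = R n - 1"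
        by (simp add: R_eq diff_divide_distrib)
      then show "((n1 n)\<^sup>2 - (n2 n)\<^sup>2) / (n2 n)\<^sup>2 \<le> \<bar>R n - 1\<bar>" by simp
    qed
    also have "\<dots> \<le> \<delta>" using \<delta>[OF F] by (simp add: R_def)
    finally have E1: "E \<le> S * \<delta>" using S0 by (simp add: mult_left_mono)
    have "S \<le> S'" unfolding S'_eq S_def
    proof (intro sum_mono)
      fix n assume "n \<in> F"
      then show "(cmod (a n))\<^sup>2 \<le> (cmod (a n))\<^sup>2 * R n"
        using mult_left_mono[OF R(1)[OF FN], of n "(cmod (a n))\<^sup>2"] by simp
    qed
    then have "c * S \<le> c * S'" using cC by simp
    then have lo: "(c - \<delta>) * S \<le> Y - E" using Y(1) E1 by (simp add: algebra_simps)
    have "S' \<le> (\<Sum>n\<in>F. (cmod (a n))\<^sup>2 * (1 + \<delta>))"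
      unfolding S'_eq using R\<delta> FN by (intro sum_mono mult_left_mono) auto
    also have "\<dots> = (1 + \<delta>) * S" by (simp only: S_def sum_distrib_left mult.commute)
    finally have "C * S' \<le> C * ((1 + \<delta>) * S)" using cC(2) by (intro mult_left_mono) auto
    then have "Y - E \<le> C * (1 + \<delta>) * S" using Y(2) E0 by (simp add: mult.assoc)
    with lo show ?thesis unfolding split S_def by simp
  qed
  then show ?thesis unfolding riesz_bounds_def using cC \<delta>0 \<delta>c by (simp add: add_pos_nonneg)
qed

end

lemma summable_tail_bound:
  fixes r :: "nat \<Rightarrow> real"
  assumes r0: "\<And>n. 0 \<le> r n" and summ: "r summable_on {1..}"
  shows "\<exists>\<delta>. \<delta> \<longlonglongrightarrow> 0 \<and> (\<forall>N\<ge>1. \<forall>F. finite F \<longrightarrow> F \<subseteq> {N..} \<longrightarrow> sum r F \<le> \<delta> N)"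
proof -
  define r' where "r' = (\<lambda>n. if n = 0 then 0 else r n)"
  have "r summable_on {1..} \<longleftrightarrow> r' summable_on UNIV"
    by (rule summable_on_cong_neutral) (auto simp: r'_def)
  then have s: "summable r'" using summ summable_on_imp_summable by blast
  define \<delta> where "\<delta> = (\<lambda>N. suminf r' - sum r' {..<N})"
  have "\<delta> \<longlonglongrightarrow> suminf r' - suminf r'"
    unfolding \<delta>_def by (intro tendsto_intros summable_LIMSEQ s)
  moreover have "sum r F \<le> \<delta> N" if "N \<ge> 1" "finite F" "F \<subseteq> {N..}" for N F
  proof -
    have "sum r F + sum r' {..<N} = sum r' F + sum r' {..<N}"
      using that by (intro arg_cong2[where f = "(+)"] sum.cong) (auto simp: r'_def)
    also have "\<dots> = sum r' (F \<union> {..<N})"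
      using that by (intro sum.union_disjoint[symmetric]) auto
    also have "\<dots> \<le> suminf r'"
      using that r0 by (intro sum_le_suminf s) (auto simp: r'_def)
    finally show ?thesis by (simp add: \<delta>_def)
  qed
  ultimately show ?thesis by (intro exI[of _ \<delta>]) auto
qed


section \<open>Stability of asymptotically orthonormal kernel sequences\<close>

context dbr_factorisation
begin

lemma AOB_up:
  assumes l: "\<And>n. n \<ge> 1 \<Longrightarrow> l n \<in> upper_half_plane"
    and summ: "(\<lambda>n. \<bar>kernel_ratio b1 H1 b2 H2 (l n) - 1\<bar>) summable_on {1..}"
    and aob: "AOB H2 1 (\<lambda>n. normalized_kernel b2 H2 (l n))"
  shows "AOB H1 1 (\<lambda>n. normalized_kernel b1 H1 (l n))"
proof -
  obtain \<delta> where lim: "\<delta> \<longlonglongrightarrow> 0" and \<delta>: "\<And>N F. N \<ge> 1 \<Longrightarrow> finite F \<Longrightarrow> F \<subseteq> {N..} \<Longrightarrow>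
      (\<Sum>n\<in>F. \<bar>kernel_ratio b1 H1 b2 H2 (l n) - 1\<bar>) \<le> \<delta> N"
    using summable_tail_bound[OF _ summ] by auto
  obtain c C where rb: "\<And>N. N \<ge> 1 \<Longrightarrow> riesz_bounds H2 (\<lambda>n. normalized_kernel b2 H2 (l n)) N (c N) (C N)"
    and cC: "c \<longlonglongrightarrow> 1" "C \<longlonglongrightarrow> 1"
    using aob unfolding AOB_iff_riesz_bounds by blast
  have "riesz_bounds H1 (\<lambda>n. normalized_kernel b1 H1 (l n)) N (c N / (1 + \<delta> N)) (C N + \<delta> N)"
    if "N \<ge> 1" for N
    using that by (intro riesz_bounds_up rb \<delta> l) auto
  moreover have "(\<lambda>N. c N / (1 + \<delta> N)) \<longlonglongrightarrow> 1 / (1 + 0)" "(\<lambda>N. C N + \<delta> N) \<longlonglongrightarrow> 1 + 0"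
    by (intro tendsto_intros cC lim; simp)+
  ultimately show ?thesis
    unfolding AOB_iff_riesz_bounds using l S1.normalized_kernel_closed
    by (intro conjI allI impI exI[of _ "\<lambda>N. c N / (1 + \<delta> N)"] exI[of _ "\<lambda>N. C N + \<delta> N"]) auto
qed

lemma AOB_down:
  assumes l: "\<And>n. n \<ge> 1 \<Longrightarrow> l n \<in> upper_half_plane"
    and summ: "(\<lambda>n. \<bar>kernel_ratio b1 H1 b2 H2 (l n) - 1\<bar>) summable_on {1..}"
    and aob: "AOB H1 1 (\<lambda>n. normalized_kernel b1 H1 (l n))"
  shows "\<exists>q\<ge>1. AOB H2 q (\<lambda>n. normalized_kernel b2 H2 (l n))"
proof -
  obtain \<delta> where lim: "\<delta> \<longlonglongrightarrow> 0" and \<delta>: "\<And>N F. N \<ge> 1 \<Longrightarrow> finite F \<Longrightarrow> F \<subseteq> {N..} \<Longrightarrow>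
      (\<Sum>n\<in>F. \<bar>kernel_ratio b1 H1 b2 H2 (l n) - 1\<bar>) \<le> \<delta> N"
    using summable_tail_bound[OF _ summ] by auto
  obtain c C where rb: "\<And>N. N \<ge> 1 \<Longrightarrow> riesz_bounds H1 (\<lambda>n. normalized_kernel b1 H1 (l n)) N (c N) (C N)"
    and cC: "c \<longlonglongrightarrow> 1" "C \<longlonglongrightarrow> 1"
    using aob unfolding AOB_iff_riesz_bounds by blast
  have "(\<lambda>N. c N - \<delta> N) \<longlonglongrightarrow> 1 - 0" by (intro tendsto_intros cC lim)
  then have "\<forall>\<^sub>F N in sequentially. 0 < c N - \<delta> N" by (intro order_tendstoD) auto
  moreover have "\<forall>\<^sub>F N in sequentially. \<delta> N < 1" using lim by (intro order_tendstoD) auto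
  ultimately have "\<forall>\<^sub>F N in sequentially. 0 < c N - \<delta> N \<and> \<delta> N < 1" by (rule eventually_conj)
  then obtain q0 where q0: "\<And>N. N \<ge> q0 \<Longrightarrow> 0 < c N - \<delta> N \<and> \<delta> N < 1"
    unfolding eventually_sequentially by blast
  define q where "q = max 1 q0"
  have q: "\<delta> N < c N" "\<delta> N < 1" "N \<ge> 1" if "N \<ge> q" for N
    using q0[of N] that by (auto simp: q_def)
  have n2: "0 < hnorm H2 (dbr_kernel b2 (l n))" if n: "n \<ge> q" for n
  proof -
    have "hnorm H2 (dbr_kernel b2 (l n)) \<noteq> 0"
    proof
      assume "hnorm H2 (dbr_kernel b2 (l n)) = 0"
      then have "kernel_ratio b1 H1 b2 H2 (l n) = 0" by (simp add: kernel_ratio_def)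
      then show False using \<delta>[OF q(3)[OF n], of "{n}"] q(2)[OF n] by simp
    qed
    then show ?thesis
      using S2.hnorm_nonneg[OF S2.kernel_closed[OF l[OF q(3)[OF n]]]] by simp
  qed
  have "riesz_bounds H2 (\<lambda>n. normalized_kernel b2 H2 (l n)) N (c N - \<delta> N) (C N * (1 + \<delta> N))"
    if "N \<ge> q" for N
    using q[OF that] that by (intro riesz_bounds_down rb \<delta> l n2) auto
  moreover have "(\<lambda>N. c N - \<delta> N) \<longlonglongrightarrow> 1 - 0" "(\<lambda>N. C N * (1 + \<delta> N)) \<longlonglongrightarrow> 1 * (1 + 0)"
    by (intro tendsto_intros cC lim)+
  ultimately have "AOB H2 q (\<lambda>n. normalized_kernel b2 H2 (l n))"
    unfolding AOB_iff_riesz_bounds using l q(3) S2.normalized_kernel_closed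
    by (intro conjI allI impI exI[of _ "\<lambda>N. c N - \<delta> N"] exI[of _ "\<lambda>N. C N * (1 + \<delta> N)"]) auto
  then show ?thesis using q(3)[of q] by blast
qed

text \<open>
  The index \<open>p\<close> is the largest one for which \<open>(l n)\<close>, \<open>n \<ge> p\<close>, is a set of uniqueness for the
  second space. Maximality gives a nonzero function vanishing at all \<open>l n\<close> with \<open>n > p\<close>; moving
  one of its zeros \<open>l m\<close> to \<open>l p\<close> gives, for each \<open>m\<close>, a function which vanishes at all points
  but \<open>l m\<close>. These functions let the finitely many missing vectors be prepended.
\<close>

lemma complete_AOB_down:
  assumes l: "\<And>n. n \<ge> 1 \<Longrightarrow> l n \<in> upper_half_plane"
    and summ: "(\<lambda>n. \<bar>kernel_ratio b1 H1 b2 H2 (l n) - 1\<bar>) summable_on {1..}"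
    and aob: "AOB H1 1 (\<lambda>n. normalized_kernel b1 H1 (l n))"
    and compl: "complete_seq H1 1 (\<lambda>n. normalized_kernel b1 H1 (l n))"
  shows "\<exists>p\<ge>1. AOB H2 p (\<lambda>n. normalized_kernel b2 H2 (l n)) \<and>
      complete_seq H2 p (\<lambda>n. normalized_kernel b2 H2 (l n))"
proof -
  define x where "x = (\<lambda>n. normalized_kernel b2 H2 (l n))"
  obtain q where q: "q \<ge> 1" "AOB H2 q x"
    using AOB_down[OF l summ aob] unfolding x_def by blast
  have xE: "x n \<in> Elts H2" if "n \<ge> 1" for n
    unfolding x_def by (rule S2.normalized_kernel_closed[OF l[OF that]])
  have inj: "l m \<noteq> l n" if "m \<ge> 1" "n \<ge> 1" "m \<noteq> n" for m n
  proof -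
    obtain c C where "riesz_bounds H1 (\<lambda>n. normalized_kernel b1 H1 (l n)) 1 c C"
      using aob unfolding AOB_iff_riesz_bounds by blast
    from inj_onD[OF S1.riesz_bounds_inj[OF this], of m n] show ?thesis using that by auto
  qed
  define uniq where "uniq = (\<lambda>p. \<forall>f\<in>Elts H2. (\<forall>n\<ge>p. f (l n) = 0) \<longrightarrow> f = (\<lambda>z. 0))"
  have uniq_complete: "complete_seq H2 p x" if "p \<ge> 1" "uniq p" for p
    unfolding x_def using that l
    by (intro S2.complete_if_uniqueness_set) (auto simp: uniq_def)
  have not_uniq: "\<not> uniq (Suc n)" if n: "n \<ge> q" for n
  proof
    assume "uniq (Suc n)"
    then have "complete_seq H2 (Suc n) x" by (intro uniq_complete) auto
    then have "x n \<in> norm_closure H2 (lin_span (x ` {Suc n..}))"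
      using xE[of n] n q(1) by (simp add: complete_seq_def)
    moreover obtain c C where "riesz_bounds H2 x n c C"
      using q(2) n unfolding AOB_iff_riesz_bounds by blast
    ultimately show False
      using S2.riesz_bounds_not_in_closure[of x n c C] xE n q(1) by auto
  qed
  define P where "P = {p. 1 \<le> p \<and> uniq p}"
  have "P \<subseteq> {..q}"
  proof
    fix p assume "p \<in> P"
    then obtain k where "p = Suc k" "uniq (Suc k)" by (cases p) (auto simp: P_def)
    then show "p \<in> {..q}" using not_uniq[of k] by (cases "q \<le> k") auto
  qed
  then have P: "finite P" by (rule finite_subset) simp
  have "1 \<in> P"
    using uniqueness_set_if_complete[OF l compl] by (auto simp: P_def uniq_def)
  define p where "p = Max P"
  have "p \<in> P" unfolding p_def using P \<open>1 \<in> P\<close> by (intro Max_in) auto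
  then have p: "1 \<le> p" "uniq p" "p \<le> q" using \<open>P \<subseteq> {..q}\<close> by (auto simp: P_def)
  have "\<not> uniq (Suc p)"
  proof
    assume "uniq (Suc p)"
    then have "Suc p \<in> P" by (simp add: P_def)
    from Max_ge[OF P this] show False by (simp add: p_def)
  qed
  then obtain f where f: "f \<in> Elts H2" "f \<noteq> (\<lambda>z. 0)" and f0: "\<And>n. n > p \<Longrightarrow> f (l n) = 0"
    unfolding uniq_def by (auto simp: Suc_le_eq)
  have fp: "f (l p) \<noteq> 0"
  proof
    assume "f (l p) = 0"
    then have "\<forall>n\<ge>p. f (l n) = 0" using f0 by (auto simp: le_less)
    then show False using p(2) f by (auto simp: uniq_def)
  qed
  have biorth: "\<exists>g\<in>Elts H2. g (l m) \<noteq> 0 \<and> (\<forall>n\<ge>p. n \<noteq> m \<longrightarrow> g (l n) = 0)" if m: "m \<ge> p" for m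
  proof (cases "m = p")
    case True
    then show ?thesis using f f0 fp by (intro bexI[of _ f]) auto
  next
    case False
    then have mp: "m > p" using m by simp
    obtain g where g: "g \<in> Elts H2" "g (l p) = 0" "g \<noteq> (\<lambda>z. 0)"
      and gz: "\<And>z. z \<in> upper_half_plane - {l m} \<Longrightarrow> f z = 0 \<Longrightarrow> g z = 0"
      using S2.exchange_zero[OF f(1) l[of m] l[of p] f0[OF mp] fp] mp p(1) by auto
    have g0: "g (l n) = 0" if n: "n \<ge> p" "n \<noteq> m" for n
    proof (cases "n = p")
      case False
      then have "f (l n) = 0" using n f0[of n] by simp
      then show ?thesis using l[of n] inj[of n m] n mp p(1) by (intro gz) auto
    qed (use g(2) in simp)
    have "g (l m) \<noteq> 0"
    proof
      assume "g (l m) = 0"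
      then have "\<forall>n\<ge>p. g (l n) = 0" using g0 by blast
      then show False using p(2) g(1,3) by (auto simp: uniq_def)
    qed
    then show ?thesis using g(1) g0 by blast
  qed
  have "AOB H2 p x"
    using p(3)
  proof (induction p rule: inc_induct)
    case base
    show ?case by (rule q(2))
  next
    case (step m)
    have m1: "m \<ge> 1" using step.hyps p(1) by simp
    obtain g where g: "g \<in> Elts H2" "g (l m) \<noteq> 0" "\<And>n. n \<ge> p \<Longrightarrow> n \<noteq> m \<Longrightarrow> g (l n) = 0"
      using biorth[of m] step.hyps by blast
    have "hnorm H2 (dbr_kernel b2 (l m)) \<noteq> 0"
      using S2.vanishes_at_degenerate_point[OF g(1) l[OF m1]] g(2) by auto
    then have "iprod H2 (x m) g \<noteq> 0"
      unfolding x_def using g(2) by (simp add: S2.iprod_normalized_kernel_left[OF g(1) l[OF m1]])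
    moreover have "iprod H2 (x n) g = 0" if "n > m" for n
      unfolding x_def using g(3)[of n] that step.hyps m1
      by (subst S2.iprod_normalized_kernel_left[OF g(1) l]) auto
    ultimately show ?case
      by - (rule S2.AOB_prepend[where g = g, OF step.IH xE[OF m1] g(1)])
  qed
  then show ?thesis using p(1) uniq_complete[OF p(1,2)] unfolding x_def by blast
qed

end

theorem theorem5p5:
  fixes b1 b2 b :: "complex \<Rightarrow> complex"
    and H1 H2 :: "complex fun_space"
    and l :: "nat \<Rightarrow> complex"
  assumes "b2 \<in> Hinf_ball" and "b \<in> Hinf_ball"
    and "\<And>z. z \<in> upper_half_plane \<Longrightarrow> b1 z = b2 z * b z"
    and "de_branges_rovnyak_space b1 H1"
    and "de_branges_rovnyak_space b2 H2"
    and "\<And>n. n \<ge> 1 \<Longrightarrow> l n \<in> upper_half_plane"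
    and "(\<lambda>n. \<bar>kernel_ratio b1 H1 b2 H2 (l n) - 1\<bar>) summable_on {1..}"
  shows "(AOB H1 1 (\<lambda>n. normalized_kernel b1 H1 (l n)) \<and>
          complete_seq H1 1 (\<lambda>n. normalized_kernel b1 H1 (l n)) \<longrightarrow>
          (\<exists>p\<ge>1. AOB H2 p (\<lambda>n. normalized_kernel b2 H2 (l n)) \<and>
                 complete_seq H2 p (\<lambda>n. normalized_kernel b2 H2 (l n))))
       \<and> (AOB H2 1 (\<lambda>n. normalized_kernel b2 H2 (l n)) \<longrightarrow>
          AOB H1 1 (\<lambda>n. normalized_kernel b1 H1 (l n)))"
proof -
  interpret dbr_factorisation b1 b2 b H1 H2
    using assms(2-5) by (intro dbr_factorisation.intro dbr_factorisation_axioms.intro)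
  show ?thesis
    using complete_AOB_down[OF assms(6,7)] AOB_up[OF assms(6,7)] by blast
qed

end
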